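(* Let $\Pi_n$ be a plane $n$-gon with side lengths $a_1,\dots,a_n$, perimeter $L_n$ and enclosed area $A_n$, and suppose that its sides satisfy the condition $$a_i<\frac{k\,L_n}{n},\qquad 1\le i\le n,\qquad 1<k<\frac32 .$$ Then the quotient $\varphi_n=\dfrac{A_n}{P_n}$, where $P_n$ is the pseudo-area of $\Pi_n$, verifies the inequalities $$\frac{4A_n}{L_n^2\left(1-\frac{2}{n}\right)^{\frac n2}}<\varphi_n<\frac{4A_n}{L_n^2\left(1-\frac{2k}{n}\right)^{\frac n2}}<\frac{1}{n\tan\frac{\pi}{n}\left(1-\frac{2k}{n}\right)^{\frac n2}},$$ with equalities if and only if the $n$-gon is regular (corresponding to $k=1$).
   Context: Here $n\ge 3$ is an integer and $L_n=\sum_{i=1}^n a_i$. The pseudo-area of an $n$-gon with side lengths $a_1,\dots,a_n$ and perimeter $L_n$ is $$P_n=\frac{L_n^2}{4}\sqrt{\left(1-\frac{2a_1}{L_n}\right)\left(1-\frac{2a_2}{L_n}\right)\cdots\left(1-\frac{2a_n}{L_n}\right)}.$$ Since $L_n=\sum_{i=1}^n a_i$, the condition $a_i<kL_n/n$ for all $i$ forces $k>1$; the value $k=1$ is taken to correspond to the regular $n$-gon (the limiting case, in which $a_i=L_n/n$ for all $i$).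
   Formalization: The strict chain fails for equilateral n-gons (e.g. a rhombus), so it is claimed strict only for k>1 and unequal sides, else with ≤; equality holds in the first relation iff equilateral, second iff k=1 (all sides L_n/n), third iff regular, and in all three iff regular and k=1. *)

theory Defs
  imports "HOL-Complex_Analysis.Complex_Analysis"
begin

fun polyline :: "complex list \<Rightarrow> real \<Rightarrow> complex" where
  "polyline [] = linepath 0 0"
| "polyline [x] = linepath x x"
| "polyline [x, y] = linepath x y"
| "polyline (x # y # z # zs) = linepath x y +++ polyline (y # z # zs)"

definition boundary_path :: "complex list \<Rightarrow> real \<Rightarrow> complex" where
  "boundary_path vs = polyline (vs @ [hd vs])"

text \<open>An \<open>n\<close>-gon is given by its cyclic list of vertices. The boundary must not cross or touch
  itself, which in particular forces distinct vertices and hence sides of positive length.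
  Straight angles and non-convex polygons are allowed.\<close>

definition ngon :: "nat \<Rightarrow> complex list \<Rightarrow> bool" where
  "ngon n vs \<longleftrightarrow> length vs = n \<and> simple_path (boundary_path vs)"

definition vertex :: "complex list \<Rightarrow> nat \<Rightarrow> complex" where
  "vertex vs i = vs ! (i mod length vs)"

definition side :: "complex list \<Rightarrow> nat \<Rightarrow> real" where
  "side vs i = dist (vertex vs i) (vertex vs (Suc i))"

definition enclosed_area :: "complex list \<Rightarrow> real" where
  "enclosed_area vs = measure lebesgue (inside (path_image (boundary_path vs)))"

definition pseudo_area :: "nat \<Rightarrow> (nat \<Rightarrow> real) \<Rightarrow> real" where
  "pseudo_area n a =
     (let L = (\<Sum>i<n. a i) in L\<^sup>2 / 4 * sqrt (\<Prod>i<n. 1 - 2 * a i / L))"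

text \<open>The signed exterior angle at vertex \<open>i + 1\<close>, in \<open>]-\<pi>, \<pi>]\<close>. For a simple polygon the
  interior angle there is \<open>\<pi>\<close> minus this value if the polygon is traversed counterclockwise and
  \<open>\<pi>\<close> plus this value otherwise, so all interior angles are equal iff all signed exterior angles
  are. Unsigned angles would not do: the equilateral Greek cross has twelve right angles up to
  orientation.\<close>

definition turning_angle :: "complex list \<Rightarrow> nat \<Rightarrow> real" where
  "turning_angle vs i =
     Arg ((vertex vs (i + 2) - vertex vs (i + 1)) / (vertex vs (i + 1) - vertex vs i))"

definition equilateral :: "complex list \<Rightarrow> bool" where
  "equilateral vs \<longleftrightarrow> (\<forall>i<length vs. \<forall>j<length vs. side vs i = side vs j)"

definition equiangular :: "complex list \<Rightarrow> bool" where
  "equiangular vs \<longleftrightarrow>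
     (\<forall>i<length vs. \<forall>j<length vs. turning_angle vs i = turning_angle vs j)"

text \<open>To be used for simple polygons only; star polygons also satisfy this predicate.\<close>

definition regular :: "complex list \<Rightarrow> bool" where
  "regular vs \<longleftrightarrow> equilateral vs \<and> equiangular vs"

end

theory Submission imports Defs begin

text \<open>
  With \<open>L\<close> the perimeter, write \<open>u i = 1 - 2 a i / L\<close>, so that
  \<open>\<phi> = 4 A / (L\<^sup>2 sqrt (\<Prod>u i))\<close>. The three members of the
  chain other than \<open>upper\<close> are
  values of the strictly decreasing function \<open>G x = 4 A / (L\<^sup>2 sqrt x)\<close>: since the \<open>u i\<close> have
  mean \<open>1 - 2 / n\<close>, the inequality of arithmetic and geometric means
  (\<open>prod_le_mean_power\<close>) gives \<open>lower \<le> \<phi>\<close> with equality for equal sides, and the bound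
  \<open>u i > 1 - 2 k / n\<close> on each factor gives
  \<open>\<phi> < middle\<close> when \<open>k > 1\<close>. What remains,
  \<open>middle \<le> upper\<close>, is the isoperimetric inequality \<open>4 n tan (\<pi> / n) A \<le> L\<^sup>2\<close> for
  simple \<open>n\<close>-gons, with equality exactly for the regular ones (\<open>polygon_isoperimetric\<close>).

  The isoperimetric inequality is proved for the signed (shoelace) area of arbitrary closed
  \<open>n\<close>-step walks. By compactness some walk maximises area for given perimeter
  (\<open>ex_max_area\<close>). Moving one vertex of a maximiser parallel to the chord of its
  neighbours changes the length but not the area; hence adjacent sides of a maximiser are equal
  (\<open>extremal_adjacent_sides\<close>). For equal sides, \<open>L\<^sup>2\<close> is \<open>n\<close> times the sum of the squared
  sides, and the comparison of that sum with the area is diagonalised by the discrete Fourier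
  transform (\<open>sum_sq_sides_minus_area\<close>); only the constant and the first Fourier mode survive in
  the case of equality, which makes the walk a regular polygon.

  The signed area is linked to the enclosed area by integrating the winding number of the boundary
  over the plane (\<open>has_integral_winding_number_boundary_path\<close>): it is a sum of winding numbers of
  triangles with apex 0, while for a simple polygon it is constantly \<open>1\<close> or \<open>-1\<close> inside and
  vanishes outside. Winding numbers also show that a simple polygon with equal sides and equal
  turning angles is no star polygon (\<open>simple_geometric_polygon_angle\<close>): about its centre the
  boundary winds \<open>n \<theta> / (2 \<pi>)\<close> times, and for a simple curve this number is at most 1 in
  absolute value.
\<close>

section \<open>Signed area and perimeter of closed walks\<close>

text \<open>The shoelace formula. Closed walks with \<open>n\<close> steps are represented as \<open>n\<close>-periodic sequences
  of vertices; cyclic shifts and the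
  closing side then need no special treatment.\<close>

definition signed_area :: "nat \<Rightarrow> (nat \<Rightarrow> complex) \<Rightarrow> real" where
  "signed_area n f = (\<Sum>i<n. Im (cnj (f i) * f (Suc i))) / 2"

definition perimeter :: "nat \<Rightarrow> (nat \<Rightarrow> complex) \<Rightarrow> real" where
  "perimeter n f = (\<Sum>i<n. dist (f i) (f (Suc i)))"

definition periodic :: "nat \<Rightarrow> (nat \<Rightarrow> 'a) \<Rightarrow> bool" where
  "periodic n f \<longleftrightarrow> (\<forall>i. f (i + n) = f i)"

lemma sum_periodic_Suc:
  fixes g :: "nat \<Rightarrow> 'a::ab_group_add"
  assumes "periodic n g"
  shows "(\<Sum>i<n. g (Suc i)) = (\<Sum>i<n. g i)"
proof -
  have "g n = g 0"
    using assms by (metis periodic_def add_0)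
  moreover have "(\<Sum>i<n. g (Suc i)) + g 0 = (\<Sum>i<n. g i) + g n"
    by (metis add.commute sum.lessThan_Suc sum.lessThan_Suc_shift)
  ultimately show ?thesis by simp
qed

lemma sum_periodic_shift:
  fixes g :: "nat \<Rightarrow> 'a::ab_group_add"
  assumes "periodic n g"
  shows "(\<Sum>i<n. g (i + m)) = (\<Sum>i<n. g i)"
proof (induction m)
  case (Suc m)
  have "periodic n (\<lambda>i. g (i + m))"
    using assms by (simp add: periodic_def add.assoc) (metis add.commute add.left_commute)
  from sum_periodic_Suc[OF this] Suc show ?case by simp
qed simp

lemma periodic_mod:
  assumes "periodic n f"
  shows "f (i mod n) = f i"
proof -
  have "f (j + n * q) = f j" for j q
  proof (induction q)
    case (Suc q)
    have "f (j + n * Suc q) = f ((j + n * q) + n)" by (simp add: algebra_simps)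
    with assms Suc show ?case by (simp add: periodic_def)
  qed simp
  from this[of "i mod n" "i div n"] show ?thesis by simp
qed

lemma signed_area_translate:
  assumes "periodic n f"
  shows "signed_area n (\<lambda>i. f i - a) = signed_area n f"
proof -
  have "Im (cnj (f i - a) * (f (Suc i) - a))
      = Im (cnj (f i) * f (Suc i)) + (Im (cnj a * f i) - Im (cnj a * f (Suc i)))" for i
    by (simp add: algebra_simps)
  moreover have "(\<Sum>i<n. Im (cnj a * f (Suc i))) = (\<Sum>i<n. Im (cnj a * f i))"
    using sum_periodic_Suc[of n "\<lambda>i. Im (cnj a * f i)"] assms by (simp add: periodic_def)
  ultimately show ?thesis
    unfolding signed_area_def by (simp only: sum.distrib sum_subtractf diff_self add_0_right)
qed

lemma signed_area_scale:
  "signed_area n (\<lambda>i. of_real r * f i) = r\<^sup>2 * signed_area n f"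
  by (simp add: signed_area_def sum_distrib_left power2_eq_square algebra_simps)

lemma perimeter_scale:
  "perimeter n (\<lambda>i. of_real r * f i) = \<bar>r\<bar> * perimeter n f"
proof -
  have "dist (of_real r * x) (of_real r * y) = \<bar>r\<bar> * dist x y" for x y :: complex
    by (simp add: dist_norm norm_mult flip: right_diff_distrib)
  then show ?thesis by (simp add: perimeter_def sum_distrib_left)
qed

lemma perimeter_translate: "perimeter n (\<lambda>i. f i - a) = perimeter n f"
  by (simp add: perimeter_def dist_norm)

lemma perimeter_nonneg: "perimeter n f \<ge> 0"
  by (simp add: perimeter_def sum_nonneg)

lemma dist_le_perimeter:
  assumes "periodic n f" "n > 0"
  shows "dist (f 0) (f i) \<le> perimeter n f"
proof -
  have *: "dist (f 0) (f m) \<le> (\<Sum>j<m. dist (f j) (f (Suc j)))" for m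
    by (induction m) (auto intro: order.trans[OF dist_triangle] add_mono)
  have "dist (f 0) (f i) = dist (f 0) (f (i mod n))"
    using assms by (simp add: periodic_mod)
  also note *
  also have "(\<Sum>j<i mod n. dist (f j) (f (Suc j))) \<le> perimeter n f"
    unfolding perimeter_def using assms by (intro sum_mono2) (auto intro: less_trans[OF _ mod_less_divisor])
  finally show ?thesis .
qed

lemma signed_area_zero_perimeter:
  assumes "periodic n f" "n > 0" "perimeter n f = 0"
  shows "signed_area n f = 0"
proof -
  have "f i = f 0" for i
    using dist_le_perimeter[OF assms(1,2), of i] assms(3) by simp
  then have "Im (cnj (f i) * f (Suc i)) = 0" for i
    by (metis mult.commute complex_norm_square Im_complex_of_real of_real_power)
  then show ?thesis by (simp add: signed_area_def)
qed

lemma signed_area_cnj: "signed_area n (\<lambda>i. cnj (f i)) = - signed_area n f"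
  by (simp add: signed_area_def sum_negf[symmetric] algebra_simps)

lemma perimeter_cnj: "perimeter n (\<lambda>i. cnj (f i)) = perimeter n f"
  by (simp add: perimeter_def dist_norm flip: complex_cnj_diff)

section \<open>Fourier analysis of closed walks\<close>

lemma roots_of_unity_orthogonal:
  assumes "k < n" "l < n"
  shows "(\<Sum>j<n. cnj (cis (2 * pi / n) ^ (k * j)) * cis (2 * pi / n) ^ (l * j))
         = (if k = l then of_nat n else 0)"
proof -
  let ?w = "cis (2 * pi / n)"
  define x where "x = cnj (?w ^ k) * ?w ^ l"
  have n: "n > 0" using assms by simp
  have wn: "?w ^ n = 1"
    using n by (simp add: Complex.DeMoivre)
  have wcnj: "?w ^ k * cnj (?w ^ k) = 1"
    by (subst complex_norm_square[symmetric]) (simp add: norm_power)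
  have xn: "x ^ n = 1"
    unfolding x_def power_mult_distrib
    by (metis complex_cnj_one complex_cnj_power mult.right_neutral power_mult mult.commute power_one wn)
  have "(\<Sum>j<n. cnj (?w ^ (k * j)) * ?w ^ (l * j)) = (\<Sum>j<n. x ^ j)"
    by (simp add: x_def power_mult power_mult_distrib)
  also have "\<dots> = (if k = l then of_nat n else 0)"
  proof (cases "x = 1")
    case True
    have "?w ^ l = ?w ^ k * x"
      unfolding x_def using wcnj by (metis mult.assoc mult.left_neutral)
    then have "cis (2 * pi * real k / real n) = cis (2 * pi * real l / real n)"
      using True by (simp add: Complex.DeMoivre mult_ac)
    then have "k = l"
      using Complex.bij_betw_roots_unity[OF n] assms by (auto simp: bij_betw_def inj_on_def)
    then show ?thesis using True by simp
  next
    case False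
    then have "k \<noteq> l" using wcnj by (auto simp: x_def mult.commute)
    then show ?thesis using False xn by (simp add: sum_gp_strict)
  qed
  finally show ?thesis .
qed

lemma fourier_expansion:
  assumes "n > 0" "periodic n f"
  obtains c where "\<And>j. f j = (\<Sum>k<n. c k * cis (2 * pi / n) ^ (k * j))"
proof
  let ?w = "cis (2 * pi / n)"
  define c where "c = (\<lambda>k. (\<Sum>l<n. cnj (?w ^ (k * l)) * f l) / of_nat n)"
  have wn: "?w ^ n = 1"
    using assms by (simp add: Complex.DeMoivre)
  have *: "f j = (\<Sum>k<n. c k * ?w ^ (k * j))" if "j < n" for j
  proof -
    have "(\<Sum>k<n. c k * ?w ^ (k * j))
        = (\<Sum>k<n. \<Sum>l<n. f l * (cnj (?w ^ (l * k)) * ?w ^ (j * k))) / of_nat n"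
      by (simp add: c_def sum_divide_distrib sum_distrib_right sum_distrib_left mult_ac)
    also have "(\<Sum>k<n. \<Sum>l<n. f l * (cnj (?w ^ (l * k)) * ?w ^ (j * k)))
        = (\<Sum>l<n. f l * (\<Sum>k<n. cnj (?w ^ (l * k)) * ?w ^ (j * k)))"
      by (subst sum.swap) (simp only: sum_distrib_left)
    also have "\<dots> = (\<Sum>l<n. if l = j then f l * of_nat n else 0)"
      using that by (intro sum.cong) (auto simp: roots_of_unity_orthogonal simp del: complex_cnj_power)
    also have "\<dots> = f j * of_nat n" using that by simp
    finally show ?thesis using assms by simp
  qed
  have wper: "?w ^ (k * j) = ?w ^ (k * (j mod n))" for k j
  proof -
    have "?w ^ j = ?w ^ (j mod n)"
      by (metis div_mult_mod_eq mult.commute mult_1 power_add power_mult power_one wn)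
    then show ?thesis by (metis mult.commute power_mult)
  qed
  show "f j = (\<Sum>k<n. c k * ?w ^ (k * j))" for j
    using *[of "j mod n"] assms by (simp add: periodic_mod flip: wper)
qed

lemma parseval_shift:
  fixes c :: "nat \<Rightarrow> complex"
  assumes "\<And>j. f j = (\<Sum>k<n. c k * cis (2 * pi / n) ^ (k * j))"
  shows "(\<Sum>j<n. cnj (f j) * f (j + s))
         = of_nat n * (\<Sum>k<n. of_real ((cmod (c k))\<^sup>2) * cis (2 * pi / n) ^ (k * s))"
proof -
  let ?w = "cis (2 * pi / n)"
  have "(\<Sum>j<n. cnj (f j) * f (j + s))
      = (\<Sum>j<n. \<Sum>k<n. \<Sum>l<n. cnj (c k) * c l * ?w ^ (l * s) * (cnj (?w ^ (k * j)) * ?w ^ (l * j)))"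
    by (simp add: assms sum_product cnj_sum algebra_simps power_add)
  also have "\<dots> = (\<Sum>k<n. \<Sum>l<n. cnj (c k) * c l * ?w ^ (l * s) * (\<Sum>j<n. cnj (?w ^ (k * j)) * ?w ^ (l * j)))"
    by (subst sum.swap, rule sum.cong, simp, subst sum.swap) (simp only: sum_distrib_left)
  also have "\<dots> = (\<Sum>k<n. \<Sum>l<n. if l = k then cnj (c k) * c k * ?w ^ (k * s) * of_nat n else 0)"
    by (intro sum.cong refl) (auto simp: roots_of_unity_orthogonal simp del: complex_cnj_power)
  also have "\<dots> = (\<Sum>k<n. cnj (c k) * c k * ?w ^ (k * s) * of_nat n)"
    by simp
  also have "\<dots> = of_nat n * (\<Sum>k<n. of_real ((cmod (c k))\<^sup>2) * ?w ^ (k * s))"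
    by (simp add: sum_distrib_left mult_ac flip: complex_norm_square)
  finally show ?thesis .
qed

text \<open>Both the sum of the squared sides and the area are invariant under cyclic shifts, so they are
  diagonal in the Fourier basis. The \<open>k\<close>-th mode contributes \<open>2 - 2 cos (2 \<pi> k / n)\<close> to the
  former and \<open>sin (2 \<pi> k / n) / 2\<close> to the latter, each times \<open>n\<close> and the squared modulus of
  the coefficient. The factor \<open>4 tan (\<pi> / n)\<close> is chosen to make the first mode cancel, and the
  addition theorems turn the remaining coefficients into products of two sines.\<close>

lemma sum_sq_sides_minus_area:
  fixes c :: "nat \<Rightarrow> complex"
  assumes n: "n \<ge> 3" and per: "periodic n f"
    and f: "\<And>j. f j = (\<Sum>k<n. c k * cis (2 * pi / n) ^ (k * j))"
  shows "(\<Sum>j<n. (dist (f j) (f (Suc j)))\<^sup>2) - 4 * tan (pi / n) * signed_area n f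
     = 4 * n / cos (pi / n) * (\<Sum>k<n. (cmod (c k))\<^sup>2 * (sin (pi * k / n) * sin (pi * (real k - 1) / n)))"
proof -
  let ?w = "cis (2 * pi / n)" and ?q = "\<lambda>k. (cmod (c k))\<^sup>2"
  have cos_pos: "cos (pi / n) > 0"
    using n by (intro cos_gt_zero) (auto simp: field_simps)
  have P: "(\<Sum>j<n. cnj (f j) * f (j + s)) =
     of_nat n * (\<Sum>k<n. of_real (?q k) * ?w ^ (k * s))" for s
    using f by (rule parseval_shift)
  have re: "Re (?w ^ k) = cos (2 * pi * k / n)" "Im (?w ^ k) = sin (2 * pi * k / n)" for k
    by (simp_all add: Complex.DeMoivre mult_ac)
  have "complex_of_real (\<Sum>j<n. (cmod (f j))\<^sup>2) = (\<Sum>j<n. cnj (f j) * f j)"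
    by (simp add: complex_norm_square mult.commute del: of_real_power)
  also have "\<dots> = complex_of_real (n * (\<Sum>k<n. ?q k))"
    using P[of 0] by simp
  finally have nrm: "(\<Sum>j<n. (cmod (f j))\<^sup>2) = n * (\<Sum>k<n. ?q k)"
    unfolding of_real_eq_iff .
  have "(\<Sum>j<n. Re (cnj (f j) * f (Suc j))) = Re (\<Sum>j<n. cnj (f j) * f (j + 1))" by simp
  also have "\<dots> = n * (\<Sum>k<n. ?q k * cos (2 * pi * k / n))"
    by (subst P) (simp add: re del: of_real_power)
  finally have real_part: "(\<Sum>j<n. Re (cnj (f j) * f (Suc j))) = n * (\<Sum>k<n. ?q k * cos (2 * pi * k / n))" .
  have "(\<Sum>j<n. Im (cnj (f j) * f (Suc j))) = Im (\<Sum>j<n. cnj (f j) * f (j + 1))" by simp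
  also have "\<dots> = n * (\<Sum>k<n. ?q k * sin (2 * pi * k / n))"
    by (subst P) (simp add: re del: of_real_power)
  finally have area: "2 * signed_area n f = n * (\<Sum>k<n. ?q k * sin (2 * pi * k / n))"
    by (simp add: signed_area_def)
  have "(\<Sum>j<n. (dist (f j) (f (Suc j)))\<^sup>2)
      = (\<Sum>j<n. (cmod (f j))\<^sup>2 + (cmod (f (Suc j)))\<^sup>2 - 2 * Re (cnj (f j) * f (Suc j)))"
    by (intro sum.cong refl, unfold dist_norm cmod_power2) (simp add: power2_eq_square algebra_simps)
  also have "\<dots> = 2 * (\<Sum>j<n. (cmod (f j))\<^sup>2) - 2 * (\<Sum>j<n. Re (cnj (f j) * f (Suc j)))"
    using sum_periodic_Suc[of n "\<lambda>j. (cmod (f j))\<^sup>2"] per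
    by (simp add: sum.distrib sum_subtractf sum_distrib_left periodic_def)
  finally have len: "(\<Sum>j<n. (dist (f j) (f (Suc j)))\<^sup>2)
     = 2 * (n * (\<Sum>k<n. ?q k)) - 2 * (n * (\<Sum>k<n. ?q k * cos (2 * pi * k / n)))"
    unfolding nrm real_part .
  have coef: "2 - 2 * cos (2 * pi * k / n) - 2 * tan (pi / n) * sin (2 * pi * k / n)
      = 4 / cos (pi / n) * (sin (pi * k / n) * sin (pi * (real k - 1) / n))" for k
  proof -
    have a: "2 * pi * k / n = 2 * (pi * k / n)" by simp
    have b: "pi * (real k - 1) / n = pi * k / n - pi / n" by (simp add: right_diff_distrib diff_divide_distrib)
    show ?thesis unfolding a b cos_double_sin sin_double sin_diff tan_def
      using cos_pos by (simp add: field_simps power2_eq_square)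
  qed
  have "(\<Sum>j<n. (dist (f j) (f (Suc j)))\<^sup>2) - 2 * tan (pi / n) * (2 * signed_area n f)
    = n * (\<Sum>k<n. ?q k * (2 - 2 * cos (2 * pi * k / n) - 2 * tan (pi / n) * sin (2 * pi * k / n)))"
    unfolding len area
    by (simp add: right_diff_distrib sum_subtractf sum_distrib_left mult_ac)
  then show ?thesis unfolding coef by (simp add: sum_distrib_left mult_ac)
qed

text \<open>Both angles lie in \<open>[0, \<pi>]\<close> unless \<open>k = 0\<close>, when the product vanishes.\<close>

lemma sin_product_nonneg:
  fixes n k :: nat
  assumes "n \<ge> 2" "k < n"
  shows "sin (pi * k / n) * sin (pi * (real k - 1) / n) \<ge> 0"
proof (cases "k = 0")
  case False
  have "pi * k \<le> pi * n" "pi * (real k - 1) \<le> pi * n"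
    using assms by (auto intro!: mult_left_mono)
  then have "pi * k / n \<le> pi" "pi * (real k - 1) / n \<le> pi"
    using assms by (auto simp: divide_le_eq)
  then show ?thesis using False by (intro mult_nonneg_nonneg sin_ge_zero) auto
qed simp

lemma area_le_sum_sq_sides:
  assumes "n \<ge> 3" "periodic n f"
  shows "4 * tan (pi / n) * signed_area n f \<le> (\<Sum>j<n. (dist (f j) (f (Suc j)))\<^sup>2)"
proof -
  from assms obtain c where c: "\<And>j. f j = (\<Sum>k<n. c k * cis (2 * pi / n) ^ (k * j))"
    by (metis fourier_expansion less_le_trans zero_less_numeral)
  have "cos (pi / n) > 0"
    using assms by (intro cos_gt_zero) (auto simp: field_simps)
  moreover have "(\<Sum>k<n. (cmod (c k))\<^sup>2 * (sin (pi * k / n) * sin (pi * (real k - 1) / n))) \<ge> 0"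
    using assms by (intro sum_nonneg mult_nonneg_nonneg sin_product_nonneg) auto
  ultimately have "0 \<le> (\<Sum>j<n. (dist (f j) (f (Suc j)))\<^sup>2) - 4 * tan (pi / n) * signed_area n f"
    unfolding sum_sq_sides_minus_area[OF assms c] by simp
  then show ?thesis by simp
qed

text \<open>All modes with \<open>k \<ge> 2\<close> have a strictly positive coefficient, so equality kills them.\<close>

lemma area_eq_sum_sq_sides_imp_regular:
  assumes n: "n \<ge> 3" and per: "periodic n f"
    and eq: "4 * tan (pi / n) * signed_area n f = (\<Sum>j<n. (dist (f j) (f (Suc j)))\<^sup>2)"
  obtains a b where "\<And>j. f j = a + b * cis (2 * pi / n) ^ j"
proof -
  from assms obtain c where c: "\<And>j. f j = (\<Sum>k<n. c k * cis (2 * pi / n) ^ (k * j))"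
    by (metis fourier_expansion less_le_trans zero_less_numeral)
  let ?t = "\<lambda>k. (cmod (c k))\<^sup>2 * (sin (pi * k / n) * sin (pi * (real k - 1) / n))"
  have "cos (pi / n) > 0"
    using n by (intro cos_gt_zero) (auto simp: field_simps)
  then have "(\<Sum>k<n. ?t k) = 0"
    using sum_sq_sides_minus_area[OF n per c] eq n by simp
  moreover have "?t k \<ge> 0" if "k < n" for k
    using n that by (intro mult_nonneg_nonneg sin_product_nonneg) auto
  ultimately have t0: "?t k = 0" if "k < n" for k
    using that by (subst (asm) sum_nonneg_eq_0_iff) auto
  have c0: "c k = 0" if "k < n" "k \<ge> 2" for k
  proof -
    have "pi * (real k - 1) < pi * n"
      using that by (intro mult_strict_left_mono) auto
    then have "sin (pi * k / n) > 0" "sin (pi * (real k - 1) / n) > 0"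
      using that by (auto intro!: sin_gt_zero simp: field_simps)
    with t0[OF that(1)] show ?thesis by simp
  qed
  have "f j = c 0 + c 1 * cis (2 * pi / n) ^ j" for j
  proof -
    have "f j = (\<Sum>k\<in>{0, 1}. c k * cis (2 * pi / n) ^ (k * j))"
      unfolding c using n c0 by (intro sum.mono_neutral_right) auto
    then show ?thesis by simp
  qed
  then show ?thesis by (rule that)
qed

section \<open>The isoperimetric inequality for closed walks\<close>

text \<open>Area over squared perimeter is invariant under similarities, so it suffices to maximise the area
  over walks of perimeter at most 1 inside the unit ball. These form a compact set in the product
  topology.\<close>

lemma ex_max_area:
  assumes n: "n > 0"
  obtains g where "periodic n g" "perimeter n g \<le> 1"
    "\<And>f. periodic n f \<Longrightarrow> signed_area n f \<le> signed_area n g * (perimeter n f)\<^sup>2"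
proof -
  define K where "K = {f. periodic n f \<and> perimeter n f \<le> 1 \<and> (\<forall>i. f i \<in> cball (0::complex) 1)}"
  have cont_coord [continuous_intros]: "continuous_on UNIV (\<lambda>f::nat \<Rightarrow> complex. f i)" for i
    by (rule continuous_on_product_coordinates)
  have "compact (PiE UNIV (\<lambda>i::nat. cball (0::complex) 1))"
    using compactin_PiE[of "\<lambda>_. euclidean" "UNIV :: nat set" "\<lambda>_. cball (0::complex) 1"]
    by (simp add: euclidean_product_topology)
  moreover have "closed {f :: nat \<Rightarrow> complex. periodic n f}"
    unfolding periodic_def by (intro closed_Collect_all closed_Collect_eq continuous_intros)
  moreover have "closed {f :: nat \<Rightarrow> complex. perimeter n f \<le> 1}"
    unfolding perimeter_def by (intro closed_Collect_le continuous_intros)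
  ultimately have "compact ((PiE UNIV (\<lambda>i::nat. cball (0::complex) 1) \<inter> {f. periodic n f}) \<inter> {f. perimeter n f \<le> 1})"
    by (intro compact_Int_closed)
  also have "(PiE UNIV (\<lambda>i::nat. cball (0::complex) 1) \<inter> {f. periodic n f}) \<inter> {f. perimeter n f \<le> 1} = K"
    by (auto simp: K_def)
  finally have "compact K" .
  moreover have "(\<lambda>_. 0) \<in> K"
    by (simp add: K_def periodic_def perimeter_def)
  moreover have "continuous_on K (signed_area n)"
    unfolding signed_area_def
    by (rule continuous_on_subset[OF _ subset_UNIV]) (intro continuous_intros, simp)
  ultimately obtain g where g: "g \<in> K" "\<And>f. f \<in> K \<Longrightarrow> signed_area n f \<le> signed_area n g"
    using continuous_attains_sup[of K "signed_area n"] by blast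
  have "signed_area n f \<le> signed_area n g * (perimeter n f)\<^sup>2" if f: "periodic n f" for f
  proof (cases "perimeter n f = 0")
    case True
    then show ?thesis using signed_area_zero_perimeter[OF f n] by simp
  next
    case False
    let ?p = "perimeter n f"
    have p: "?p > 0" using False perimeter_nonneg[of n f] by simp
    define h where "h = (\<lambda>i. of_real (1 / ?p) * (f i - f 0))"
    have "periodic n h"
      using f by (simp add: h_def periodic_def)
    moreover have "perimeter n h = 1"
      using p unfolding h_def perimeter_scale perimeter_translate by simp
    moreover have "h i \<in> cball 0 1" for i
      using dist_le_perimeter[OF f n, of i] p
      by (simp add: h_def norm_divide dist_norm norm_minus_commute)
    ultimately have "h \<in> K" by (simp add: K_def)
    then have "signed_area n h \<le> signed_area n g" by (rule g)
    moreover have "signed_area n h = signed_area n f / ?p\<^sup>2"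
      unfolding h_def signed_area_scale signed_area_translate[OF f] by (simp add: power_divide)
    ultimately show ?thesis using p by (simp add: divide_le_eq)
  qed
  then show ?thesis
    by (rule that[rotated 2]) (use g(1) in \<open>simp_all add: K_def\<close>)
qed

text \<open>The quotient of area and squared perimeter is maximal; the inequality is cross-multiplied so that
  walks of perimeter 0 need no exception.\<close>

definition extremal :: "nat \<Rightarrow> (nat \<Rightarrow> complex) \<Rightarrow> bool" where
  "extremal n f \<longleftrightarrow> periodic n f \<and> signed_area n f > 0 \<and>
     (\<forall>g. periodic n g \<longrightarrow> signed_area n g * (perimeter n f)\<^sup>2 \<le> signed_area n f * (perimeter n g)\<^sup>2)"

lemma move_vertex:
  assumes n: "n \<ge> 3" and per: "periodic n f"
  defines "g \<equiv> \<lambda>v i. if i mod n = 1 then v else f i"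
  shows "periodic n (g v)"
    and "signed_area n (g v) = signed_area n f + Im (cnj (v - f 1) * (f 2 - f 0)) / 2"
    and "perimeter n (g v) = perimeter n f - (dist (f 0) (f 1) + dist (f 1) (f 2))
           + (dist (f 0) v + dist v (f 2))"
proof -
  show "periodic n (g v)"
    using per by (simp add: g_def periodic_def)
  have g0: "g v 0 = f 0" "g v 1 = v" "g v 2 = f 2"
    using n by (auto simp: g_def)
  have g2: "g v i = f i" "g v (Suc i) = f (Suc i)" if "i \<in> {2..<n}" for i
    using that n by (auto simp: g_def mod_Suc)
  have split: "(\<Sum>i<n. F i) = F 0 + F 1 + (\<Sum>i\<in>{2..<n}. F i)" for F :: "nat \<Rightarrow> real"
  proof -
    have "{..<n} = insert 0 (insert 1 {2..<n})" using n by auto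
    then show ?thesis by simp
  qed
  have "(\<Sum>i\<in>{2..<n}. Im (cnj (g v i) * g v (Suc i))) = (\<Sum>i\<in>{2..<n}. Im (cnj (f i) * f (Suc i)))"
    by (intro sum.cong) (simp_all add: g2)
  then show "signed_area n (g v) = signed_area n f + Im (cnj (v - f 1) * (f 2 - f 0)) / 2"
    unfolding signed_area_def split using g0 by (simp add: field_simps numeral_2_eq_2)
  have "(\<Sum>i\<in>{2..<n}. dist (g v i) (g v (Suc i))) = (\<Sum>i\<in>{2..<n}. dist (f i) (f (Suc i)))"
    by (intro sum.cong) (simp_all add: g2)
  then show "perimeter n (g v) = perimeter n f - (dist (f 0) (f 1) + dist (f 1) (f 2))
           + (dist (f 0) v + dist v (f 2))"
    unfolding perimeter_def split using g0 by (simp add: numeral_2_eq_2)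
qed

lemma extremal_perimeter_pos:
  assumes "n > 0" "extremal n f"
  shows "perimeter n f > 0"
  using assms signed_area_zero_perimeter[of n f] perimeter_nonneg[of n f]
  by (force simp: extremal_def)

lemma extremal_not_shortenable:
  assumes n: "n \<ge> 3" and ext: "extremal n f" and same: "Im (cnj (v - f 1) * (f 2 - f 0)) = 0"
  shows "dist (f 0) (f 1) + dist (f 1) (f 2) \<le> dist (f 0) v + dist v (f 2)"
proof -
  have per: "periodic n f" and S: "signed_area n f > 0" using ext by (auto simp: extremal_def)
  let ?g = "\<lambda>i. if i mod n = 1 then v else f i"
  note g = move_vertex[OF n per, of v]
  have "signed_area n ?g * (perimeter n f)\<^sup>2 \<le> signed_area n f * (perimeter n ?g)\<^sup>2"
    using ext g(1) unfolding extremal_def by blast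
  then have "(perimeter n f)\<^sup>2 \<le> (perimeter n ?g)\<^sup>2"
    using g(2) same S by simp
  then have "perimeter n f \<le> perimeter n ?g"
    by (rule power2_le_imp_le) (rule perimeter_nonneg)
  with g(3) show ?thesis by simp
qed

text \<open>Pushing the midpoint of a straight pair of sides outwards by \<open>t\<close> times the chord gains area of
  order \<open>t\<close>, but perimeter only of order \<open>t\<^sup>2\<close>.\<close>

lemma extremal_not_straight:
  assumes n: "n \<ge> 3" and ext: "extremal n f" and ne: "f 0 \<noteq> f 2"
  shows "Im (cnj (f 1 - f 0) * (f 2 - f 0)) \<noteq> 0"
proof
  assume straight: "Im (cnj (f 1 - f 0) * (f 2 - f 0)) = 0"
  define d where "d = f 2 - f 0"
  define m where "m = (f 0 + f 2) / 2"
  have d: "cmod d > 0" using ne by (simp add: d_def)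
  have per: "periodic n f" and S: "signed_area n f > 0" using ext by (auto simp: extremal_def)
  let ?S = "signed_area n f" and ?P = "perimeter n f"
  have P: "?P > 0" using ext n by (intro extremal_perimeter_pos) auto
  have key: "cmod d * ?P\<^sup>2 \<le> t * (8 * ?S * (?P + cmod d))" if t: "0 < t" "t \<le> 1" for t :: real
  proof -
    \<comment> \<open>The direction \<open>- \<i> d\<close> points to the right of the chord, where the area increases.\<close>
    define v where "v = m - \<i> * of_real t * d"
    let ?g = "\<lambda>i. if i mod n = 1 then v else f i"
    note g = move_vertex[OF n per, of v]
    have "cnj (v - f 1) * (f 2 - f 0)
        = cnj (m - f 0) * d - cnj (f 1 - f 0) * (f 2 - f 0) + \<i> * of_real t * (d * cnj d)"
      by (simp add: v_def d_def algebra_simps)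
    also have "cnj (m - f 0) = cnj d / 2"
      by (simp add: m_def d_def field_simps)
    also have "cnj d / 2 * d - cnj (f 1 - f 0) * (f 2 - f 0) + \<i> * of_real t * (d * cnj d)
        = of_real ((cmod d)\<^sup>2 / 2) - cnj (f 1 - f 0) * (f 2 - f 0) + \<i> * of_real (t * (cmod d)\<^sup>2)"
      by (simp add: complex_norm_square[symmetric] mult.commute)
    finally have "Im (cnj (v - f 1) * (f 2 - f 0)) = t * (cmod d)\<^sup>2"
      using straight by simp
    then have area: "signed_area n ?g = ?S + t * (cmod d)\<^sup>2 / 2" using g(2) by simp
    have half: "cmod (1 / 2 + \<i> * of_real s) \<le> 1 / 2 + t\<^sup>2" if "s\<^sup>2 = t\<^sup>2" for s
    proof -
      have "(1 / 2)\<^sup>2 + s\<^sup>2 \<le> (1 / 2 + t\<^sup>2)\<^sup>2"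
        using that by (simp add: power2_sum power_divide)
      then show ?thesis unfolding cmod_def by (intro real_le_lsqrt) auto
    qed
    have "f 0 - v = - (d * (1 / 2 + \<i> * of_real (- t)))" "v - f 2 = - (d * (1 / 2 + \<i> * of_real t))"
      by (simp_all add: v_def m_def d_def field_simps)
    then have "dist (f 0) v = cmod d * cmod (1 / 2 + \<i> * of_real (- t))"
      "dist v (f 2) = cmod d * cmod (1 / 2 + \<i> * of_real t)"
      by (simp_all only: dist_norm norm_minus_cancel norm_mult)
    then have "dist (f 0) v \<le> cmod d * (1 / 2 + t\<^sup>2)" "dist v (f 2) \<le> cmod d * (1 / 2 + t\<^sup>2)"
      using half[of "-t"] half[of t] by (simp_all only: mult_left_mono norm_ge_zero power2_minus)
    moreover have "cmod d \<le> dist (f 0) (f 1) + dist (f 1) (f 2)"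
      unfolding d_def using dist_triangle[of "f 0" "f 2" "f 1"] by (simp add: dist_norm norm_minus_commute)
    ultimately have "perimeter n ?g \<le> ?P + 2 * cmod d * t\<^sup>2"
      using g(3) by (simp add: algebra_simps)
    then have "(perimeter n ?g)\<^sup>2 \<le> (?P + 2 * cmod d * t\<^sup>2)\<^sup>2"
      by (intro power_mono perimeter_nonneg)
    then have "?S * (perimeter n ?g)\<^sup>2 \<le> ?S * (?P + 2 * cmod d * t\<^sup>2)\<^sup>2"
      using S by simp
    moreover have "signed_area n ?g * ?P\<^sup>2 \<le> ?S * (perimeter n ?g)\<^sup>2"
      using ext g(1) unfolding extremal_def by blast
    ultimately have "(?S + t * (cmod d)\<^sup>2 / 2) * ?P\<^sup>2 \<le> ?S * (?P + 2 * cmod d * t\<^sup>2)\<^sup>2"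
      unfolding area by linarith
    then have "(t * cmod d) * (cmod d * ?P\<^sup>2) \<le> (t * cmod d) * (t * (8 * ?S * (?P + cmod d * t\<^sup>2)))"
      by (simp add: power2_eq_square algebra_simps)
    then have "cmod d * ?P\<^sup>2 \<le> t * (8 * ?S * (?P + cmod d * t\<^sup>2))"
      using t d by (subst (asm) mult_le_cancel_left_pos) auto
    also have "\<dots> \<le> t * (8 * ?S * (?P + cmod d))"
      using t S d by (intro mult_left_mono add_left_mono mult_left_le power_le_one) auto
    finally show ?thesis .
  qed
  \<comment> \<open>For small \<open>t\<close> the inequality \<open>e \<le> t * c\<close> fails; half the critical value is small enough.\<close>
  define c where "c = 8 * ?S * (?P + cmod d)"
  have c: "c > 0" using S P by (simp add: c_def add_pos_nonneg)
  define e where "e = cmod d * ?P\<^sup>2"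
  have e: "e > 0" using P d by (simp add: e_def)
  have "e \<le> min 1 (e / (2 * c)) * c"
    using key[of "min 1 (e / (2 * c))"] c e by (simp add: e_def c_def)
  also have "\<dots> \<le> e / (2 * c) * c" using c by (intro mult_right_mono) auto
  also have "\<dots> = e / 2" using c by simp
  finally show False using e by simp
qed

text \<open>In the coordinate \<open>q\<close> in which the neighbours of the vertex are 0 and 1, the sides have
  lengths proportional to \<open>|q|\<close> and \<open>|1 - cnj q|\<close>. Replacing \<open>q\<close> by the mean \<open>r\<close> of \<open>q\<close> and
  its mirror image \<open>1 - cnj q\<close> keeps the height and hence the area, so extremality forces
  equality in the triangle inequality for \<open>q\<close> and \<open>1 - cnj q\<close>. As these have the same
  imaginary part, which is nonzero by the preceding lemma, their moduli agree.\<close>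

lemma extremal_adjacent_sides:
  assumes n: "n \<ge> 3" and ext: "extremal n f"
  shows "dist (f 0) (f 1) = dist (f 1) (f 2)"
proof (cases "f 0 = f 2")
  case True
  then show ?thesis
    by (simp add: dist_commute)
next
  case False
  define d where "d = f 2 - f 0"
  have d0: "d \<noteq> 0" using False by (simp add: d_def)
  define q where "q = (f 1 - f 0) / d"
  have f1: "f 1 = f 0 + q * d" using d0 by (simp add: q_def)
  have f2: "f 2 = f 0 + d" by (simp add: d_def)
  have "cnj (f 1 - f 0) * (f 2 - f 0) = cnj q * of_real ((cmod d)\<^sup>2)"
    unfolding f1 f2 by (simp add: complex_norm_square mult_ac del: of_real_power)
  then have y: "Im q \<noteq> 0"
    using extremal_not_straight[OF n ext False] by auto
  define p where "p = 1 - cnj q"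
  have sides: "dist (f 0) (f 1) = cmod d * cmod q" "dist (f 1) (f 2) = cmod d * cmod p"
  proof -
    show "dist (f 0) (f 1) = cmod d * cmod q"
      unfolding f1 by (simp add: dist_norm norm_mult)
    have "f 1 - f 2 = - (d * cnj p)" unfolding f1 f2 p_def by (simp add: algebra_simps)
    then show "dist (f 1) (f 2) = cmod d * cmod p"
      by (simp only: dist_norm norm_minus_cancel norm_mult complex_mod_cnj)
  qed
  define r where "r = (q + p) / 2"
  have r: "r = Complex (1 / 2) (Im q)"
    by (simp add: r_def p_def complex_eq_iff)
  define v where "v = f 0 + r * d"
  have "cnj (v - f 1) * (f 2 - f 0) = cnj (r - q) * of_real ((cmod d)\<^sup>2)"
    unfolding f1 f2 v_def by (simp add: complex_norm_square algebra_simps del: of_real_power)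
  then have "Im (cnj (v - f 1) * (f 2 - f 0)) = 0"
    by (simp add: r)
  from extremal_not_shortenable[OF n ext this]
  have "cmod d * (cmod q + cmod p) \<le> dist (f 0) v + dist v (f 2)"
    unfolding sides by (simp add: distrib_left)
  also have "dist (f 0) v = cmod d * cmod r"
    by (simp add: v_def dist_norm norm_mult)
  also have "dist v (f 2) = cmod d * cmod r"
  proof -
    have "v - f 2 = - (d * cnj r)"
      by (simp add: v_def f2 algebra_simps) (simp add: r complex_eq_iff algebra_simps)
    then show ?thesis by (simp only: dist_norm norm_minus_cancel norm_mult complex_mod_cnj)
  qed
  finally have "cmod d * (cmod q + cmod p) \<le> cmod d * (2 * cmod r)" by (simp add: algebra_simps)
  then have "cmod q + cmod p \<le> 2 * cmod r"
    using d0 by simp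
  also have "2 * cmod r = cmod (q + p)" by (simp add: r_def norm_divide)
  finally have "cmod (q + p) = cmod q + cmod p"
    using norm_triangle_ineq[of q p] by simp
  then have "cmod q *\<^sub>R p = cmod p *\<^sub>R q"
    by (simp only: norm_triangle_eq)
  then have "Im (cmod q *\<^sub>R p) = Im (cmod p *\<^sub>R q)" by simp
  then have "cmod q = cmod p"
    using y by (simp add: p_def)
  then show ?thesis unfolding sides by simp
qed

lemma extremal_shift:
  assumes "extremal n f"
  shows "extremal n (\<lambda>i. f (i + m))"
proof -
  have per: "periodic n f" using assms by (simp add: extremal_def)
  have "periodic n (\<lambda>i. f (i + m))"
    using per unfolding periodic_def by (metis add.assoc add.commute)
  moreover have "signed_area n (\<lambda>i. f (i + m)) = signed_area n f"
    using sum_periodic_shift[of n "\<lambda>i. Im (cnj (f i) * f (Suc i))" m] per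
    by (simp add: signed_area_def periodic_def flip: add_Suc)
  moreover have "perimeter n (\<lambda>i. f (i + m)) = perimeter n f"
    using sum_periodic_shift[of n "\<lambda>i. dist (f i) (f (Suc i))" m] per
    by (simp add: perimeter_def periodic_def flip: add_Suc)
  ultimately show ?thesis using assms by (simp add: extremal_def)
qed

lemma extremal_equal_sides:
  assumes "n \<ge> 3" "extremal n f"
  shows "dist (f i) (f (Suc i)) = dist (f 0) (f 1)"
proof (induction i)
  case (Suc i)
  then show ?case
    using extremal_adjacent_sides[OF assms(1) extremal_shift[OF assms(2), of i]]
    by (simp add: numeral_2_eq_2)
qed simp

lemma extremal_sum_sq_sides:
  assumes "n \<ge> 3" "extremal n f"
  shows "n * (\<Sum>i<n. (dist (f i) (f (Suc i)))\<^sup>2) = (perimeter n f)\<^sup>2"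
proof -
  have "perimeter n f = n * dist (f 0) (f 1)"
    unfolding perimeter_def extremal_equal_sides[OF assms] by simp
  moreover have "(\<Sum>i<n. (dist (f i) (f (Suc i)))\<^sup>2) = n * (dist (f 0) (f 1))\<^sup>2"
    unfolding extremal_equal_sides[OF assms] by simp
  ultimately show ?thesis by (simp add: power2_eq_square)
qed

text \<open>The bound is first obtained for a maximiser, whose equal sides allow passing between \<open>L\<^sup>2\<close> and
  the sum of the squared sides; maximality then carries it to every walk.\<close>

theorem isoperimetric_signed_area:
  assumes n: "n \<ge> 3" and per: "periodic n f"
  shows "4 * real n * tan (pi / n) * signed_area n f \<le> (perimeter n f)\<^sup>2"
proof (cases "signed_area n f > 0")
  case False
  have "tan (pi / n) > 0" using n by (intro tan_gt_zero) (auto simp: field_simps)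
  then have "4 * real n * tan (pi / n) * signed_area n f \<le> 0"
    using False by (intro mult_nonneg_nonpos) auto
  then show ?thesis by (rule order.trans) simp
next
  case True
  have tan: "tan (pi / n) > 0" using n by (intro tan_gt_zero) (auto simp: field_simps)
  obtain g where g: "periodic n g" "perimeter n g \<le> 1"
    and max: "\<And>f. periodic n f \<Longrightarrow> signed_area n f \<le> signed_area n g * (perimeter n f)\<^sup>2"
    using ex_max_area[of n] n by (metis less_le_trans zero_less_numeral)
  have S: "signed_area n g > 0"
    using max[OF per] True by (metis less_le_trans not_less zero_le_power2 mult_nonpos_nonneg)
  have P1: "(perimeter n g)\<^sup>2 \<le> 1"
    using g(2) perimeter_nonneg by (simp add: power_le_one)
  have "signed_area n h * (perimeter n g)\<^sup>2 \<le> signed_area n g * (perimeter n h)\<^sup>2" if "periodic n h" for h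
  proof (cases "signed_area n h > 0")
    case True
    then have "signed_area n h * (perimeter n g)\<^sup>2 \<le> signed_area n h"
      using P1 by (simp add: mult_left_le)
    with max[OF that] show ?thesis by simp
  next
    case False
    then have "signed_area n h * (perimeter n g)\<^sup>2 \<le> 0"
      by (intro mult_nonpos_nonneg) auto
    also have "\<dots> \<le> signed_area n g * (perimeter n h)\<^sup>2" using S by simp
    finally show ?thesis .
  qed
  then have "extremal n g" using g S by (simp add: extremal_def)
  have "n * (4 * tan (pi / n) * signed_area n g) \<le> (perimeter n g)\<^sup>2"
    unfolding extremal_sum_sq_sides[OF n \<open>extremal n g\<close>, symmetric]
    using area_le_sum_sq_sides[OF n g(1)] by (intro mult_left_mono) auto
  with P1 have g1: "4 * real n * tan (pi / n) * signed_area n g \<le> 1"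
    by (simp add: mult_ac)
  have "4 * real n * tan (pi / n) * signed_area n f \<le> 4 * real n * tan (pi / n) * (signed_area n g * (perimeter n f)\<^sup>2)"
    using tan max[OF per] by (intro mult_left_mono) auto
  also have "\<dots> = (4 * real n * tan (pi / n) * signed_area n g) * (perimeter n f)\<^sup>2" by simp
  also have "\<dots> \<le> 1 * (perimeter n f)\<^sup>2" using g1 by (intro mult_right_mono) auto
  finally show ?thesis by simp
qed

text \<open>A walk attaining the bound is itself extremal, hence has equal sides, and then attains equality in
  the Fourier estimate.\<close>

theorem isoperimetric_signed_area_eq:
  assumes n: "n \<ge> 3" and per: "periodic n f" and S: "signed_area n f > 0"
    and eq: "4 * real n * tan (pi / n) * signed_area n f = (perimeter n f)\<^sup>2"
  obtains a b where "\<And>j. f j = a + b * cis (2 * pi / n) ^ j"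
proof -
  have "signed_area n g * (perimeter n f)\<^sup>2 \<le> signed_area n f * (perimeter n g)\<^sup>2" if "periodic n g" for g
    using isoperimetric_signed_area[OF n that] S
    unfolding eq[symmetric] by (simp add: mult.commute mult.left_commute)
  then have "extremal n f" using per S by (simp add: extremal_def)
  from extremal_sum_sq_sides[OF n this] eq n
  have "4 * tan (pi / n) * signed_area n f = (\<Sum>i<n. (dist (f i) (f (Suc i)))\<^sup>2)"
    by (simp add: mult_ac flip: eq)
  from area_eq_sum_sq_sides_imp_regular[OF n per this] that show ?thesis by blast
qed

section \<open>Enclosed area as an integral of winding numbers\<close>

text \<open>Transfers the known area of triangles from \<open>real ^ 2\<close> to the complex plane.\<close>

definition planar_coords :: "complex \<Rightarrow> real ^ 2" where
  "planar_coords z = vector [Re z, Im z]"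

lemma planar_coords_nth [simp]:
  "planar_coords z $ 1 = Re z" "planar_coords z $ 2 = Im z"
  by (simp_all add: planar_coords_def)

lemma linear_planar_coords: "linear planar_coords"
  by (rule linearI) (simp_all add: vec_eq_iff forall_2)

lemma inj_planar_coords: "inj planar_coords"
  by (rule injI) (simp add: vec_eq_iff forall_2 complex_eq_iff)

lemma lborel_distr_planar_coords: "distr lborel borel planar_coords = lborel"
proof (rule lborel_eqI[symmetric])
  fix l u :: "real ^ 2"
  assume le: "\<And>b. b \<in> Basis \<Longrightarrow> l \<bullet> b \<le> u \<bullet> b"
  have [measurable]: "planar_coords \<in> borel_measurable borel"
    using linear_planar_coords by (intro borel_measurable_continuous_onI linear_continuous_on) (simp add: linear_linear)
  have basis: "(\<Prod>b\<in>Basis. g b) = g (axis 1 1) * g (axis 2 1)" for g :: "real ^ 2 \<Rightarrow> real"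
  proof -
    have "(Basis :: (real ^ 2) set) = {axis 1 1, axis 2 1}"
      by (auto simp: Basis_vec_def) (metis exhaust_2)
    moreover have "axis 1 1 \<noteq> (axis 2 1 :: real ^ 2)"
      by (simp add: axis_eq_axis)
    ultimately show ?thesis by (subst \<open>Basis = _\<close>, subst prod.insert) auto
  qed
  have leb: "l $ 1 \<le> u $ 1" "l $ 2 \<le> u $ 2"
    using le[of "axis 1 1"] le[of "axis 2 1"] by (auto simp: inner_axis)
  have "planar_coords -` box l u = box (Complex (l $ 1) (l $ 2)) (Complex (u $ 1) (u $ 2))"
    by (auto simp: mem_box_cart forall_2 in_box_complex_iff)
  then have "emeasure (distr lborel borel planar_coords) (box l u)
      = emeasure lborel (box (Complex (l $ 1) (l $ 2)) (Complex (u $ 1) (u $ 2)))"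
    by (subst emeasure_distr) auto
  also have "\<dots> = ennreal (\<Prod>b\<in>Basis. (u - l) \<bullet> b)"
    using leb by (subst emeasure_lborel_box)
      (auto simp: Basis_complex_def basis inner_axis simp del: emeasure_lborel_box)
  finally show "emeasure (distr lborel borel planar_coords) (box l u) = (\<Prod>b\<in>Basis. (u - l) \<bullet> b)" .
qed simp

lemma measure_triangle:
  "measure lebesgue (convex hull {0, a, b :: complex}) = \<bar>Im (cnj a * b)\<bar> / 2"
proof -
  let ?T = "convex hull {0, a, b}" and ?p = planar_coords
  have cont: "continuous_on UNIV ?p"
    using linear_planar_coords by (simp add: linear_continuous_on linear_linear)
  have clT: "closed ?T"
    by (intro compact_imp_closed finite_imp_compact_convex_hull) auto
  have hull: "convex hull {?p 0, ?p a, ?p b} = ?p ` ?T"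
    using convex_hull_linear_image[OF linear_planar_coords, of "{0, a, b}"] by simp
  have clp: "closed (?p ` ?T)"
    unfolding hull[symmetric] by (intro compact_imp_closed finite_imp_compact_convex_hull) auto
  have "measure lebesgue ?T = measure lborel (?p -` (?p ` ?T))"
    using clT inj_planar_coords by (simp add: inj_vimage_image_eq)
  also have "\<dots> = measure (distr lborel borel ?p) (?p ` ?T)"
    using clp cont by (subst measure_distr) (auto intro: borel_measurable_continuous_onI)
  also have "\<dots> = measure lborel (convex hull {?p 0, ?p a, ?p b})"
    unfolding lborel_distr_planar_coords hull ..
  also have "\<dots> = \<bar>Im (cnj a * b)\<bar> / 2"
    by (subst content_triangle) (simp add: linear_0[OF linear_planar_coords] algebra_simps)
  finally show ?thesis .
qed

definition triangle_path :: "complex \<Rightarrow> complex \<Rightarrow> real \<Rightarrow> complex" where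
  "triangle_path a b = linepath 0 a +++ linepath a b +++ linepath b 0"

lemma path_image_triangle_path:
  "path_image (triangle_path a b) = frontier (convex hull {0, a, b})"
  by (subst frontier_of_triangle) (auto simp: triangle_path_def path_image_join)

text \<open>A triangle with nonzero signed area is traversed counterclockwise exactly when that area is
  positive. For an interior point \<open>z = u a + v b\<close> the orientation test of
  \<open>winding_number_triangle\<close> evaluates to \<open>v\<close> times twice the signed area.\<close>

lemma winding_number_triangle_path:
  assumes z: "z \<notin> path_image (triangle_path a b)" and nz: "Im (cnj a * b) \<noteq> 0"
  shows "winding_number (triangle_path a b) z
         = of_real (sgn (Im (cnj a * b)) * indicator (convex hull {0, a, b}) z)"
proof (cases "z \<in> convex hull {0, a, b}")
  case True
  with z have int: "z \<in> interior (convex hull {0, a, b})"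
    unfolding path_image_triangle_path frontier_def using closure_subset by blast
  from True obtain u v where uv: "u \<ge> 0" "v \<ge> 0" "u + v \<le> 1" "z = u *\<^sub>R a + v *\<^sub>R b"
    unfolding convex_hull_3_alt by auto
  have "v \<noteq> 0"
  proof
    assume "v = 0"
    then have "z \<in> closed_segment 0 a"
      using uv by (auto simp: in_segment)
    with z show False by (auto simp: triangle_path_def path_image_join)
  qed
  with uv have "v > 0" by simp
  have "Im ((a - 0) * cnj (a - z)) = v * Im (cnj a * b)"
    by (simp add: uv algebra_simps)
  with \<open>v > 0\<close> have "0 < Im ((a - 0) * cnj (a - z)) \<longleftrightarrow> 0 < Im (cnj a * b)"
    by (simp add: zero_less_mult_iff)
  with winding_number_triangle[OF int] True nz show ?thesis
    by (auto simp: triangle_path_def sgn_real_def)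
next
  case False
  have "winding_number (triangle_path a b) z = 0"
    by (rule winding_number_zero_outside[OF _ _ _ False])
       (use compact_imp_closed[OF finite_imp_compact_convex_hull, of "{0, a, b}"] in
         \<open>auto simp: triangle_path_def path_image_triangle_path[unfolded triangle_path_def]
            frontier_def closure_closed\<close>)
  with False show ?thesis by simp
qed

lemma negligible_path_image_triangle_path: "negligible (path_image (triangle_path a b))"
  unfolding path_image_triangle_path by (intro negligible_convex_frontier convex_convex_hull)

lemma has_integral_winding_number_triangle_path:
  "((\<lambda>z. Re (winding_number (triangle_path a b) z)) has_integral Im (cnj a * b) / 2) UNIV"
proof -
  let ?T = "convex hull {0, a, b}" and ?D = "Im (cnj a * b)"
  have lm: "?T \<in> lmeasurable"
    by (intro lmeasurable_compact finite_imp_compact_convex_hull) auto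
  show ?thesis
  proof (cases "?D = 0")
    case True
    have "negligible ?T"
      using lm True measure_triangle[of a b] by (simp add: negligible_iff_measure0)
    then have neg: "negligible (?T \<union> path_image (triangle_path a b))"
      using negligible_path_image_triangle_path by (rule negligible_Un)
    have sub: "path_image (triangle_path a b) \<subseteq> ?T"
      using compact_imp_closed[OF finite_imp_compact_convex_hull, of "{0, a, b}"]
      by (auto simp: path_image_triangle_path frontier_def)
    have W: "Re (winding_number (triangle_path a b) z) = 0"
      if "z \<in> UNIV - (?T \<union> path_image (triangle_path a b))" for z
      using that sub winding_number_zero_outside[of "triangle_path a b" ?T z]
      by (auto simp: triangle_path_def)
    show ?thesis
      using has_integral_spike[OF neg W has_integral_0] True by simp
  next
    case False
    have "(indicator ?T has_integral \<bar>?D\<bar> / 2) UNIV"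
      using lm unfolding lmeasurable_iff_has_integral measure_triangle .
    from has_integral_mult_right[OF this, of "sgn ?D"]
    have "((\<lambda>z. sgn ?D * indicator ?T z) has_integral ?D / 2) UNIV"
      by (simp add: sgn_mult_abs)
    then show ?thesis
      by (rule has_integral_spike[OF negligible_path_image_triangle_path[of a b], rotated])
         (use False in \<open>simp add: winding_number_triangle_path del: complex_cnj_mult times_complex.sel of_real_mult\<close>)
  qed
qed

lemma polyline_properties:
  assumes "length ps \<ge> 2"
  shows "valid_path (polyline ps) \<and> pathstart (polyline ps) = hd ps \<and> pathfinish (polyline ps) = last ps
     \<and> path_image (polyline ps) = (\<Union>i<length ps - 1. closed_segment (ps ! i) (ps ! Suc i))"
  using assms
proof (induction ps rule: polyline.induct)
  case (4 x y z zs)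
  let ?ps = "y # z # zs"
  have IH: "valid_path (polyline ?ps)" "pathstart (polyline ?ps) = y"
    "pathfinish (polyline ?ps) = last ?ps"
    "path_image (polyline ?ps) = (\<Union>i<length ?ps - 1. closed_segment (?ps ! i) (?ps ! Suc i))"
    using 4 by simp_all
  have "(\<Union>i<Suc (Suc (length zs)). closed_segment ((x # ?ps) ! i) ((x # ?ps) ! Suc i))
      = closed_segment x y \<union> (\<Union>i<Suc (length zs). closed_segment (?ps ! i) (?ps ! Suc i))"
    by (subst lessThan_Suc_eq_insert_0) (simp add: image_image)
  then show ?case using IH
    by (simp add: valid_path_join path_image_join)
qed (auto simp: lessThan_Suc)

lemma contour_integral_polyline:
  assumes "length ps \<ge> 2" "z \<notin> path_image (polyline ps)"
  shows "contour_integral (polyline ps) (\<lambda>w. 1 / (w - z))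
     = (\<Sum>i<length ps - 1. contour_integral (linepath (ps ! i) (ps ! Suc i)) (\<lambda>w. 1 / (w - z)))"
  using assms
proof (induction ps rule: polyline.induct)
  case (4 x y z' zs)
  let ?ps = "y # z' # zs"
  have P: "valid_path (polyline ?ps)" "pathstart (polyline ?ps) = y"
    using polyline_properties[of ?ps] by simp_all
  then have pi: "path_image (polyline (x # ?ps)) = closed_segment x y \<union> path_image (polyline ?ps)"
    by (simp add: path_image_join)
  with 4 have notin: "z \<notin> closed_segment x y" "z \<notin> path_image (polyline ?ps)"
    by auto
  have "contour_integral (polyline (x # ?ps)) (\<lambda>w. 1 / (w - z))
     = contour_integral (linepath x y) (\<lambda>w. 1 / (w - z)) + contour_integral (polyline ?ps) (\<lambda>w. 1 / (w - z))"
    using P notin by (simp add: contour_integrable_inversediff)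
  also have "contour_integral (polyline ?ps) (\<lambda>w. 1 / (w - z))
     = (\<Sum>i<length ?ps - 1. contour_integral (linepath (?ps ! i) (?ps ! Suc i)) (\<lambda>w. 1 / (w - z)))"
    using notin by (intro 4) auto
  finally show ?case
    by (simp add: sum.lessThan_Suc_shift del: sum.lessThan_Suc polyline.simps)
qed (auto simp: lessThan_Suc)

lemma vertex_Suc_nth:
  assumes "i < length vs"
  shows "(vs @ [hd vs]) ! i = vertex vs i" "(vs @ [hd vs]) ! Suc i = vertex vs (Suc i)"
proof -
  have "vs \<noteq> []" using assms by auto
  then show "(vs @ [hd vs]) ! i = vertex vs i" "(vs @ [hd vs]) ! Suc i = vertex vs (Suc i)"
    using assms by (auto simp: vertex_def nth_append mod_Suc hd_conv_nth)
qed

lemma boundary_path_properties: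
  assumes "vs \<noteq> []"
  shows "valid_path (boundary_path vs)" "pathstart (boundary_path vs) = hd vs"
    "pathfinish (boundary_path vs) = hd vs"
    "path_image (boundary_path vs) = (\<Union>i<length vs. closed_segment (vertex vs i) (vertex vs (Suc i)))"
proof -
  have "length (vs @ [hd vs]) \<ge> 2" using assms by (cases vs) auto
  note P = polyline_properties[OF this]
  show "valid_path (boundary_path vs)" "pathstart (boundary_path vs) = hd vs"
    "pathfinish (boundary_path vs) = hd vs"
    using P assms by (auto simp: boundary_path_def)
  show "path_image (boundary_path vs) = (\<Union>i<length vs. closed_segment (vertex vs i) (vertex vs (Suc i)))"
    using P assms by (auto simp: boundary_path_def vertex_Suc_nth)
qed

lemma contour_integral_boundary_path:
  assumes "vs \<noteq> []" "z \<notin> path_image (boundary_path vs)"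
  shows "contour_integral (boundary_path vs) (\<lambda>w. 1 / (w - z))
     = (\<Sum>i<length vs. contour_integral (linepath (vertex vs i) (vertex vs (Suc i))) (\<lambda>w. 1 / (w - z)))"
proof -
  have "length (vs @ [hd vs]) \<ge> 2" using assms by (cases vs) auto
  from contour_integral_polyline[OF this, of z] assms show ?thesis
    by (simp add: boundary_path_def vertex_Suc_nth)
qed

lemma periodic_vertex: "periodic (length vs) (vertex vs)"
  by (simp add: periodic_def vertex_def)

text \<open>In the sum over the fan of triangles with apex 0, every segment from the apex to a vertex is
  traversed once in each direction, so only the sides of the polygon remain.\<close>

lemma winding_number_boundary_path:
  assumes "vs \<noteq> []" and z: "z \<notin> path_image (boundary_path vs)"
    and zT: "\<And>i. i < length vs \<Longrightarrow> z \<notin> path_image (triangle_path (vertex vs i) (vertex vs (Suc i)))"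
  shows "winding_number (boundary_path vs) z
     = (\<Sum>i<length vs. winding_number (triangle_path (vertex vs i) (vertex vs (Suc i))) z)"
proof -
  let ?I = "\<lambda>a b. contour_integral (linepath a b) (\<lambda>w. 1 / (w - z))" and ?v = "vertex vs"
  have T: "winding_number (triangle_path (?v i) (?v (Suc i))) z
     = 1 / (2 * pi * \<i>) * (?I (?v i) (?v (Suc i)) + (?I 0 (?v i) - ?I 0 (?v (Suc i))))"
    if "i < length vs" for i
  proof -
    have rev: "?I (?v (Suc i)) 0 = - ?I 0 (?v (Suc i))"
      using contour_integral_reversepath[of "linepath 0 (?v (Suc i))" "\<lambda>w. 1 / (w - z)"] by simp
    have z': "z \<notin> closed_segment 0 (?v i)" "z \<notin> closed_segment (?v i) (?v (Suc i))"
        "z \<notin> closed_segment (?v (Suc i)) 0"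
      using zT[OF that] by (auto simp: triangle_path_def path_image_join)
    have "winding_number (triangle_path (?v i) (?v (Suc i))) z = 1 / (2 * pi * \<i>) *
       (?I 0 (?v i) + (?I (?v i) (?v (Suc i)) + ?I (?v (Suc i)) 0))"
      using zT[OF that] z' unfolding triangle_path_def
      by (subst winding_number_valid_path) (auto simp: valid_path_join contour_integrable_inversediff)
    then show ?thesis unfolding rev by (simp add: algebra_simps)
  qed
  have per: "periodic (length vs) (\<lambda>i. ?I 0 (?v i))"
    using periodic_vertex by (simp add: periodic_def)
  have "(\<Sum>i<length vs. winding_number (triangle_path (?v i) (?v (Suc i))) z)
     = 1 / (2 * pi * \<i>) * (\<Sum>i<length vs. ?I (?v i) (?v (Suc i)) + (?I 0 (?v i) - ?I 0 (?v (Suc i))))"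
    unfolding sum_distrib_left by (intro sum.cong refl T) auto
  also have "\<dots> = 1 / (2 * pi * \<i>) * (\<Sum>i<length vs. ?I (?v i) (?v (Suc i)))"
    unfolding sum.distrib sum_subtractf using sum_periodic_Suc[OF per] by simp
  also have "\<dots> = winding_number (boundary_path vs) z"
    using assms by (simp add: winding_number_valid_path boundary_path_properties contour_integral_boundary_path)
  finally show ?thesis ..
qed

lemma negligible_path_image_boundary_path:
  assumes "vs \<noteq> []"
  shows "negligible (path_image (boundary_path vs))"
proof -
  have "negligible (closed_segment a b)" for a b :: complex
    by (simp add: negligible_convex_interior interior_closed_segment_ge2)
  then show ?thesis
    using assms by (auto simp: boundary_path_properties)
qed

text \<open>The finitely many segments on which the winding numbers fail to add up are negligible.\<close>

lemma has_integral_winding_number_boundary_path: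
  assumes "vs \<noteq> []"
  shows "((\<lambda>z. Re (winding_number (boundary_path vs) z)) has_integral signed_area (length vs) (vertex vs)) UNIV"
proof -
  let ?T = "\<lambda>i. triangle_path (vertex vs i) (vertex vs (Suc i))"
  let ?N = "path_image (boundary_path vs) \<union> (\<Union>i<length vs. path_image (?T i))"
  have neg: "negligible ?N"
    using assms negligible_path_image_boundary_path negligible_path_image_triangle_path by auto
  have W: "Re (winding_number (boundary_path vs) z) = (\<Sum>i<length vs. Re (winding_number (?T i) z))"
    if "z \<in> UNIV - ?N" for z
    using that assms by (subst winding_number_boundary_path) auto
  have "((\<lambda>z. \<Sum>i<length vs. Re (winding_number (?T i) z)) has_integral signed_area (length vs) (vertex vs)) UNIV"
    unfolding signed_area_def sum_divide_distrib
    by (intro has_integral_sum has_integral_winding_number_triangle_path) auto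
  from has_integral_spike[OF neg W this] show ?thesis .
qed

lemma enclosed_area_eq_abs_signed_area:
  assumes ne: "vs \<noteq> []" and simp: "simple_path (boundary_path vs)"
  shows "enclosed_area vs = \<bar>signed_area (length vs) (vertex vs)\<bar>" and "enclosed_area vs > 0"
proof -
  let ?p = "boundary_path vs" and ?In = "inside (path_image (boundary_path vs))"
  have loop: "pathfinish ?p = pathstart ?p"
    using ne by (simp add: boundary_path_properties)
  have lm: "?In \<in> lmeasurable"
    using simp by (intro lmeasurable_open bounded_inside open_inside)
      (auto simp: compact_imp_bounded compact_imp_closed compact_simple_path_image)
  have open_in: "open ?In"
    using simp by (intro open_inside) (auto simp: compact_imp_closed compact_simple_path_image)
  obtain s :: real where s: "\<bar>s\<bar> = 1" and
    in_s: "\<And>z. z \<in> ?In \<Longrightarrow> Re (winding_number ?p z) = s"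
  proof (rule simple_closed_path_winding_number_inside[OF simp])
    assume "\<And>z. z \<in> ?In \<Longrightarrow> winding_number ?p z = 1"
    then show thesis by (intro that[of 1]) auto
  next
    assume "\<And>z. z \<in> ?In \<Longrightarrow> winding_number ?p z = -1"
    then show thesis by (intro that[of "-1"]) auto
  qed
  have W: "Re (winding_number ?p z) = s * indicator ?In z"
    if "z \<in> UNIV - path_image ?p" for z
  proof (cases "z \<in> ?In")
    case False
    then have "z \<in> outside (path_image ?p)"
      using that by (metis ComplI DiffE UnE inside_Un_outside)
    then have "winding_number ?p z = 0"
      using loop simp by (intro winding_number_zero_in_outside) (auto simp: simple_path_imp_path)
    then show ?thesis using False by simp
  qed (simp add: in_s)
  have "((\<lambda>z. s * indicator ?In z) has_integral s * measure lebesgue ?In) UNIV"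
    using lm unfolding lmeasurable_iff_has_integral by (rule has_integral_mult_right)
  from has_integral_spike[OF negligible_path_image_boundary_path[OF ne] W this]
  have "s * measure lebesgue ?In = signed_area (length vs) (vertex vs)"
    using has_integral_winding_number_boundary_path[OF ne] by (rule has_integral_unique)
  then have "\<bar>signed_area (length vs) (vertex vs)\<bar> = \<bar>s\<bar> * measure lebesgue ?In"
    by (metis abs_mult abs_of_nonneg measure_nonneg)
  with s show "enclosed_area vs = \<bar>signed_area (length vs) (vertex vs)\<bar>"
    by (simp add: enclosed_area_def)
  have "?In \<noteq> {}"
    using Jordan_inside_outside[OF simp loop] by simp
  with open_in have "\<not> negligible ?In" by (rule open_not_negligible)
  with lm show "enclosed_area vs > 0"
    unfolding enclosed_area_def by (simp add: negligible_iff_measure0 less_le)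
qed

section \<open>Regular polygons\<close>

text \<open>After translation of the centre to 0, all fan triangles are rotated copies of one another.\<close>

lemma signed_area_geometric:
  assumes "cmod r = 1" "periodic n (\<lambda>j. a + b * r ^ j)"
  shows "signed_area n (\<lambda>j. a + b * r ^ j) = n / 2 * (cmod b)\<^sup>2 * Im r"
proof -
  have "signed_area n (\<lambda>j. a + b * r ^ j) = signed_area n (\<lambda>j. b * r ^ j)"
    using signed_area_translate[OF assms(2), of a] by simp
  moreover have "Im (cnj (b * r ^ j) * (b * r ^ Suc j)) = (cmod b)\<^sup>2 * Im r" for j
  proof -
    have "cnj (b * r ^ j) * (b * r ^ Suc j) = ((b * r ^ j) * cnj (b * r ^ j)) * r"
      by (simp add: mult_ac)
    also have "\<dots> = of_real ((cmod b)\<^sup>2) * r"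
      unfolding complex_norm_square[symmetric] using assms(1) by (simp add: norm_mult norm_power)
    finally have eq: "cnj (b * r ^ j) * (b * r ^ Suc j) = of_real ((cmod b)\<^sup>2) * r" .
    show ?thesis unfolding eq by (simp del: of_real_power)
  qed
  ultimately show ?thesis by (simp add: signed_area_def)
qed

lemma perimeter_geometric:
  assumes "cmod r = 1"
  shows "perimeter n (\<lambda>j. a + b * r ^ j) = n * cmod b * cmod (r - 1)"
proof -
  have "dist (a + b * r ^ j) (a + b * r ^ Suc j) = cmod b * cmod (r - 1)" for j
  proof -
    have "a + b * r ^ j - (a + b * r ^ Suc j) = - (b * r ^ j * (r - 1))"
      by (simp add: algebra_simps)
    then show ?thesis
      using assms by (simp only: dist_norm norm_minus_cancel norm_mult norm_power) simp
  qed
  then show ?thesis by (simp add: perimeter_def)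
qed

text \<open>Rescaled by \<open>1 / c\<close> around \<open>a\<close>, the side runs from 1 to \<open>cis \<theta>\<close>. It avoids the branch
  cut of \<open>Ln\<close> because \<open>cis \<theta>\<close> is not real, so \<open>Ln ((w - a) / c)\<close> is a primitive along it.\<close>

lemma contour_integral_rotating_side:
  assumes theta: "- pi < \<theta>" "\<theta> \<le> pi" and r: "r = cis \<theta>" "Im r \<noteq> 0" and c: "c \<noteq> 0"
  shows "a \<notin> closed_segment (a + c) (a + c * r)"
    and "contour_integral (linepath (a + c) (a + c * r)) (\<lambda>w. 1 / (w - a)) = \<i> * \<theta>"
proof -
  have seg: "(w - a) / c \<notin> \<real>\<^sub>\<le>\<^sub>0" if "w \<in> closed_segment (a + c) (a + c * r)" for w
  proof
    assume nonpos: "(w - a) / c \<in> \<real>\<^sub>\<le>\<^sub>0"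
    from that obtain u where u: "w = (1 - u) *\<^sub>R (a + c) + u *\<^sub>R (a + c * r)"
      by (auto simp: in_segment)
    have eq: "(w - a) / c = of_real (1 - u) + of_real u * r"
      unfolding u using c by (simp add: scaleR_conv_of_real field_simps)
    with nonpos r(2) have "u = 0" by (auto simp: complex_nonpos_Reals_iff)
    with eq nonpos show False by simp
  qed
  then show "a \<notin> closed_segment (a + c) (a + c * r)" by force
  have "((\<lambda>w. Ln ((w - a) / c)) has_field_derivative 1 / (w - a))
      (at w within closed_segment (a + c) (a + c * r))"
    if "w \<in> closed_segment (a + c) (a + c * r)" for w
  proof -
    have "w \<noteq> a" using seg[OF that] by auto
    then show ?thesis
      using seg[OF that] c by (auto intro!: derivative_eq_intros simp: field_simps)
  qed
  then have "((\<lambda>w. 1 / (w - a)) has_contour_integral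
      (Ln ((pathfinish (linepath (a + c) (a + c * r)) - a) / c) -
       Ln ((pathstart (linepath (a + c) (a + c * r)) - a) / c))) (linepath (a + c) (a + c * r))"
    by (intro contour_integral_primitive[where S = "closed_segment (a + c) (a + c * r)"]) auto
  moreover have "Ln r = \<i> * \<theta>"
    using theta unfolding r(1) cis_conv_exp by (subst Ln_exp) auto
  ultimately show "contour_integral (linepath (a + c) (a + c * r)) (\<lambda>w. 1 / (w - a)) = \<i> * \<theta>"
    using c by (intro contour_integral_unique) auto
qed

text \<open>Each side contributes the angle \<open>\<theta>\<close>, so the boundary winds \<open>n \<theta> / (2 \<pi>)\<close> times around
  \<open>a\<close>. This number is nonzero, while simplicity confines it to \<open>{-1, 0, 1}\<close>. Star polygons are
  thereby excluded without looking at crossings of their sides.\<close>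

lemma simple_geometric_polygon_angle:
  assumes ne: "vs \<noteq> []" and simp: "simple_path (boundary_path vs)"
    and theta: "- pi < \<theta>" "\<theta> \<le> pi" and im: "sin \<theta> \<noteq> 0" and b: "b \<noteq> 0"
    and vs: "\<And>j. vertex vs j = a + b * cis \<theta> ^ j"
  shows "\<bar>\<theta>\<bar> = 2 * pi / length vs"
proof -
  let ?p = "boundary_path vs" and ?n = "length vs"
  have side: "a \<notin> closed_segment (vertex vs i) (vertex vs (Suc i))"
    "contour_integral (linepath (vertex vs i) (vertex vs (Suc i))) (\<lambda>w. 1 / (w - a)) = \<i> * \<theta>" for i
    using contour_integral_rotating_side[OF theta refl, of "b * cis \<theta> ^ i" a] im b
    by (simp_all add: vs mult_ac)
  have a: "a \<notin> path_image ?p"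
    using side ne by (simp add: boundary_path_properties)
  have "winding_number ?p a = of_real (?n * \<theta> / (2 * pi))"
    using a ne by (simp add: winding_number_valid_path boundary_path_properties
        contour_integral_boundary_path side)
  moreover have "winding_number ?p a \<in> {-1, 0, 1}"
    using simp ne a by (intro simple_closed_path_winding_number_cases) (auto simp: boundary_path_properties)
  ultimately have "complex_of_real (?n * \<theta> / (2 * pi)) \<in> {of_real (-1), of_real 0, of_real 1}"
    by (simp del: of_real_divide of_real_mult)
  then have cases: "?n * \<theta> / (2 * pi) \<in> {-1, 0, 1}"
    unfolding insert_iff of_real_eq_iff by simp
  have "\<theta> \<noteq> 0" using im by auto
  then have nz: "?n * \<theta> / (2 * pi) \<noteq> 0" using ne by simp
  have "\<bar>x\<bar> = 1" if "x \<in> {-1, 0, 1}" "x \<noteq> 0" for x :: real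
    using that by auto
  from this[OF cases nz] have "\<bar>?n * \<theta> / (2 * pi)\<bar> = 1" .
  then show ?thesis
    unfolding abs_divide abs_mult using ne by (simp add: field_simps)
qed

lemma isoperimetric_equality_geometric:
  assumes n: "n \<ge> 3" and theta: "\<bar>\<theta>\<bar> = 2 * pi / n" and per: "periodic n (\<lambda>j. a + b * cis \<theta> ^ j)"
  shows "4 * real n * tan (pi / n) * \<bar>signed_area n (\<lambda>j. a + b * cis \<theta> ^ j)\<bar>
     = (perimeter n (\<lambda>j. a + b * cis \<theta> ^ j))\<^sup>2"
proof -
  define x where "x = pi / n"
  have x: "0 < x" "x < pi / 2" using n by (auto simp: x_def field_simps)
  then have cos: "cos x > 0" and sin: "sin x > 0"
    by (auto intro: cos_gt_zero sin_gt_zero)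
  have th: "\<theta> = 2 * x \<or> \<theta> = - (2 * x)" using theta by (auto simp: x_def)
  have im: "\<bar>sin \<theta>\<bar> = 2 * sin x * cos x"
    using th sin cos by (auto simp: sin_double abs_mult)
  have "(cmod (cis \<theta> - 1))\<^sup>2 = 2 - 2 * cos \<theta>"
    unfolding cmod_power2 using sin_cos_squared_add[of \<theta>]
    by (simp add: power2_eq_square algebra_simps)
  also have "cos \<theta> = cos (2 * x)" using th by auto
  also have "2 - 2 * cos (2 * x) = 4 * (sin x)\<^sup>2"
    by (simp add: cos_double_sin)
  finally have nrm: "(cmod (cis \<theta> - 1))\<^sup>2 = 4 * (sin x)\<^sup>2" .
  have "4 * real n * tan x * \<bar>signed_area n (\<lambda>j. a + b * cis \<theta> ^ j)\<bar>
      = 4 * real n * tan x * (n / 2 * (cmod b)\<^sup>2 * (2 * sin x * cos x))"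
    using per by (subst signed_area_geometric) (simp_all add: abs_mult im)
  also have "\<dots> = n\<^sup>2 * (cmod b)\<^sup>2 * (4 * (sin x)\<^sup>2)"
    using cos by (simp add: tan_def power2_eq_square)
  also have "\<dots> = (perimeter n (\<lambda>j. a + b * cis \<theta> ^ j))\<^sup>2"
    by (subst perimeter_geometric) (simp_all add: power_mult_distrib nrm)
  finally show ?thesis by (simp add: x_def)
qed

lemma perimeter_vertex: "perimeter (length vs) (vertex vs) = (\<Sum>i<length vs. side vs i)"
  by (simp add: perimeter_def side_def)

lemma geometric_imp_regular:
  assumes b: "b \<noteq> 0" and r: "cmod r = 1" "r \<noteq> 1" and vs: "\<And>j. vertex vs j = a + b * r ^ j"
  shows "regular vs"
proof -
  have diff: "vertex vs (Suc i) - vertex vs i = b * r ^ i * (r - 1)" for i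
    by (simp add: vs algebra_simps)
  have "side vs i = cmod b * cmod (r - 1)" for i
    using r by (simp only: side_def dist_norm norm_minus_commute[of "vertex vs i"] diff norm_mult norm_power) simp
  moreover have "turning_angle vs i = Arg r" for i
    using b r by (simp add: turning_angle_def diff)
  ultimately show ?thesis
    by (simp add: regular_def equilateral_def equiangular_def)
qed

text \<open>Successive edge vectors differ by the constant factor \<open>r = cis \<theta>\<close>, so the vertices are partial
  sums of a geometric series. The hypothesis on the area excludes both the degenerate point and the
  walk going back and forth along a segment (\<open>\<theta> = \<pi>\<close>).\<close>

lemma regular_imp_geometric:
  assumes n: "length vs = n" "n > 0" and reg: "regular vs" and S: "signed_area n (vertex vs) \<noteq> 0"
  obtains a b \<theta> where "- pi < \<theta>" "\<theta> \<le> pi" "sin \<theta> \<noteq> 0" "b \<noteq> 0"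
    "\<And>j. vertex vs j = a + b * cis \<theta> ^ j"
proof -
  let ?f = "vertex vs"
  have per: "periodic n ?f" using n periodic_vertex by auto
  have m: "?f (i mod n + k) = ?f (i + k)" for i k
    using n by (simp add: vertex_def mod_add_left_eq)
  define e where "e = (\<lambda>i. ?f (Suc i) - ?f i)"
  define \<theta> where "\<theta> = turning_angle vs 0"
  define r where "r = cis \<theta>"
  have ne: "i mod n < length vs" "0 < length vs" for i using n by simp_all
  have "side vs (i mod n) = side vs i" for i
    using m[of i 0] m[of i 1] by (simp add: side_def)
  moreover have "side vs (i mod n) = side vs 0" for i
    using reg ne(1)[of i] ne(2) unfolding regular_def equilateral_def by blast
  ultimately have "side vs i = side vs 0" for i by metis
  then have ce: "cmod (e i) = cmod (e 0)" for i
    by (simp add: side_def e_def dist_norm norm_minus_commute)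
  have "turning_angle vs (i mod n) = turning_angle vs i" for i
    using m[of i 0] m[of i 1] m[of i 2] by (simp add: turning_angle_def)
  moreover have "turning_angle vs (i mod n) = \<theta>" for i
    using reg ne(1)[of i] ne(2) unfolding regular_def equiangular_def \<theta>_def by blast
  ultimately have "turning_angle vs i = \<theta>" for i by metis
  then have ta: "Arg (e (Suc i) / e i) = \<theta>" for i
    by (simp add: turning_angle_def e_def)
  have e0: "e 0 \<noteq> 0"
  proof
    assume "e 0 = 0"
    then have "perimeter n ?f = 0"
      using ce by (simp add: perimeter_def e_def dist_norm norm_minus_commute)
    with signed_area_zero_perimeter[OF per n(2)] S show False by simp
  qed
  then have ei: "e i \<noteq> 0" for i using ce[of i] by auto
  have step: "e (Suc i) = e i * r" for i
  proof -
    have "cmod (e (Suc i) / e i) = 1"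
      using ce[of i] ce[of "Suc i"] e0 by (simp add: norm_divide)
    then have "e (Suc i) / e i = r"
      using cis_Arg[of "e (Suc i) / e i"] ei by (simp add: ta r_def sgn_eq)
    then show ?thesis using ei[of i] by (simp add: field_simps)
  qed
  have e: "e i = e 0 * r ^ i" for i
    by (induction i) (simp_all add: step)
  have r1: "r \<noteq> 1"
  proof
    assume "r = 1"
    then have *: "?f (Suc i) = ?f i + e 0" for i using e[of i] by (simp add: e_def algebra_simps)
    have "?f i = ?f 0 + of_nat i * e 0" for i
      by (induction i) (simp_all add: * algebra_simps)
    moreover have "?f n = ?f 0" using per unfolding periodic_def by (metis add_0)
    ultimately have "of_nat n * e 0 = 0" by (metis add_cancel_right_right)
    then show False using e0 n by simp
  qed
  define b where "b = e 0 / (r - 1)"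
  define a where "a = ?f 0 - b"
  have f: "?f j = a + b * cis \<theta> ^ j" for j
  proof (induction j)
    case (Suc j)
    have "?f (Suc j) = ?f j + e 0 * r ^ j" using e[of j] by (simp add: e_def algebra_simps)
    also have "e 0 = b * (r - 1)" using r1 by (simp add: b_def)
    finally show ?case using Suc by (simp add: r_def algebra_simps)
  qed (simp add: a_def)
  have ff: "?f = (\<lambda>j. a + b * cis \<theta> ^ j)" using f by blast
  have "sin \<theta> \<noteq> 0"
    using S signed_area_geometric[of "cis \<theta>" n a b] per unfolding ff by auto
  moreover have "- pi < \<theta>" "\<theta> \<le> pi"
    using Arg_bounded by (auto simp: \<theta>_def turning_angle_def)
  moreover have "b \<noteq> 0" using e0 r1 by (simp add: b_def)
  ultimately show ?thesis using f by (intro that)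
qed

section \<open>The isoperimetric inequality for simple polygons\<close>

text \<open>Clockwise polygons are reduced to counterclockwise ones by complex conjugation.\<close>

theorem polygon_isoperimetric:
  assumes n: "n \<ge> 3" and ngon: "ngon n vs"
  shows "4 * real n * tan (pi / n) * enclosed_area vs \<le> (\<Sum>i<n. side vs i)\<^sup>2"
    and "4 * real n * tan (pi / n) * enclosed_area vs = (\<Sum>i<n. side vs i)\<^sup>2 \<longleftrightarrow> regular vs"
    and "enclosed_area vs > 0"
proof -
  have len: "length vs = n" and simp: "simple_path (boundary_path vs)"
    using ngon by (auto simp: ngon_def)
  have ne: "vs \<noteq> []" using len n by auto
  let ?f = "vertex vs"
  have per: "periodic n ?f" using periodic_vertex[of vs] len by simp
  have L: "(\<Sum>i<n. side vs i) = perimeter n ?f" using perimeter_vertex[of vs] len by simp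
  have A: "enclosed_area vs = \<bar>signed_area n ?f\<bar>" and pos: "enclosed_area vs > 0"
    using enclosed_area_eq_abs_signed_area[OF ne simp] len by auto
  show "enclosed_area vs > 0" by (rule pos)
  have per': "periodic n (\<lambda>i. cnj (?f i))" using per by (simp add: periodic_def)
  show "4 * real n * tan (pi / n) * enclosed_area vs \<le> (\<Sum>i<n. side vs i)\<^sup>2"
    using isoperimetric_signed_area[OF n per] isoperimetric_signed_area[OF n per']
    unfolding signed_area_cnj perimeter_cnj L A by (simp add: abs_if)
  show "4 * real n * tan (pi / n) * enclosed_area vs = (\<Sum>i<n. side vs i)\<^sup>2 \<longleftrightarrow> regular vs"
  proof
    assume eq: "4 * real n * tan (pi / n) * enclosed_area vs = (\<Sum>i<n. side vs i)\<^sup>2"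
    obtain a b r where r: "cmod r = 1" "r \<noteq> 1" and f: "\<And>j. ?f j = a + b * r ^ j"
    proof -
      have "0 < 2 * pi / n" "2 * pi / n < pi" using n by (auto simp: field_simps)
      then have "sin (2 * pi / n) \<noteq> 0" by (metis less_irrefl sin_gt_zero)
      then have w: "cis (2 * pi / n) \<noteq> 1" by (auto simp: complex_eq_iff)
      show ?thesis
      proof (cases "signed_area n ?f > 0")
        case True
        with eq have "4 * real n * tan (pi / n) * signed_area n ?f = (perimeter n ?f)\<^sup>2"
          by (simp add: A L)
        from isoperimetric_signed_area_eq[OF n per True this] that w show ?thesis
          by (metis norm_cis)
      next
        case False
        with pos have S: "signed_area n (\<lambda>i. cnj (?f i)) > 0"
          by (simp add: A signed_area_cnj)
        with eq have "4 * real n * tan (pi / n) * signed_area n (\<lambda>i. cnj (?f i)) = (perimeter n (\<lambda>i. cnj (?f i)))\<^sup>2"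
          by (simp add: A L signed_area_cnj perimeter_cnj)
        from isoperimetric_signed_area_eq[OF n per' S this]
        obtain a b where "\<And>j. cnj (?f j) = a + b * cis (2 * pi / n) ^ j" by blast
        then have "?f j = cnj (a + b * cis (2 * pi / n) ^ j)" for j
          by (metis complex_cnj_cnj)
        then show ?thesis
          using w by (intro that[of "cnj (cis (2 * pi / n))" "cnj a" "cnj b"])
            (auto simp del: cis_cnj simp: complex_cnj_one_iff)
      qed
    qed
    have "b \<noteq> 0"
    proof
      assume "b = 0"
      then have "perimeter n ?f = 0" by (simp add: perimeter_def f)
      then show False using signed_area_zero_perimeter[OF per] n pos by (simp add: A)
    qed
    then show "regular vs" using r f by (rule geometric_imp_regular)
  next
    assume reg: "regular vs"
    have "signed_area n ?f \<noteq> 0" using pos by (simp add: A)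
    moreover have "n > 0" using n by simp
    ultimately obtain a b \<theta> where th: "- pi < \<theta>" "\<theta> \<le> pi" "sin \<theta> \<noteq> 0" "b \<noteq> 0"
      and f: "\<And>j. ?f j = a + b * cis \<theta> ^ j"
      using regular_imp_geometric[OF len _ reg] by metis
    have ff: "?f = (\<lambda>j. a + b * cis \<theta> ^ j)" using f by blast
    have "\<bar>\<theta>\<bar> = 2 * pi / n"
      using simple_geometric_polygon_angle[OF ne simp th f] len by simp
    from isoperimetric_equality_geometric[OF n this] per
    show "4 * real n * tan (pi / n) * enclosed_area vs = (\<Sum>i<n. side vs i)\<^sup>2"
      unfolding A L ff by simp
  qed
qed

section \<open>Bounds for the quotient of area and pseudo-area\<close>

text \<open>Arithmetic and geometric means with the case of equality: sum \<open>ln x \<le> x - 1\<close> over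
  \<open>x = u i / m\<close>, where the right-hand sides add up to 0; equality holds only at \<open>x = 1\<close>.\<close>

lemma prod_le_mean_power:
  fixes u :: "nat \<Rightarrow> real" and m :: real
  assumes pos: "\<And>i. i < n \<Longrightarrow> u i > 0" and m: "m > 0" and sum: "(\<Sum>i<n. u i) = n * m"
  shows "(\<Prod>i<n. u i) \<le> m ^ n"
    and "(\<Prod>i<n. u i) = m ^ n \<longleftrightarrow> (\<forall>i<n. u i = m)"
proof -
  define t where "t = (\<lambda>i. u i / m - 1 - ln (u i / m))"
  have t: "t i \<ge> 0" if "i < n" for i
    using ln_le_minus_one[of "u i / m"] pos[OF that] m by (simp add: t_def)
  have prodpos: "(\<Prod>i<n. u i) > 0" using pos by (intro prod_pos) auto
  have "(\<Sum>i<n. ln (u i / m)) = ln (\<Prod>i<n. u i) - n * ln m"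
  proof -
    have "(\<Sum>i<n. ln (u i / m)) = (\<Sum>i<n. ln (u i) - ln m)"
      using pos m by (intro sum.cong) (force simp: ln_div)+
    also have "(\<Sum>i<n. ln (u i)) = ln (\<Prod>i<n. u i)"
      using pos by (intro ln_prod[symmetric]) force+
    then have "(\<Sum>i<n. ln (u i) - ln m) = ln (\<Prod>i<n. u i) - n * ln m"
      by (simp add: sum_subtractf)
    finally show ?thesis .
  qed
  then have "(\<Sum>i<n. t i) = n * ln m - ln (\<Prod>i<n. u i)"
    using sum m by (simp add: t_def sum_subtractf flip: sum_divide_distrib)
  then have tsum: "(\<Sum>i<n. t i) = ln (m ^ n) - ln (\<Prod>i<n. u i)"
    using m by (simp add: ln_realpow)
  have "(\<Sum>i<n. t i) \<ge> 0" using t by (intro sum_nonneg) auto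
  then show "(\<Prod>i<n. u i) \<le> m ^ n"
    using tsum prodpos m by simp
  show "(\<Prod>i<n. u i) = m ^ n \<longleftrightarrow> (\<forall>i<n. u i = m)"
  proof
    assume "(\<Prod>i<n. u i) = m ^ n"
    then have "(\<Sum>i<n. t i) = 0" using tsum by simp
    then have "t i = 0" if "i < n" for i
      using t that by (subst (asm) sum_nonneg_eq_0_iff) auto
    then have "u i / m = 1" if "i < n" for i
      using that pos[OF that] m by (intro ln_eq_minus_one) (auto simp: t_def)
    then show "\<forall>i<n. u i = m" using m by auto
  qed simp
qed

lemma powr_half_nat: "x > 0 \<Longrightarrow> x powr (real n / 2) = sqrt (x ^ n)"
  by (simp add: powr_half_sqrt[symmetric] powr_powr flip: powr_realpow)

theorem proposition2p1:
  fixes n :: nat and vs :: "complex list" and a :: "nat \<Rightarrow> real"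
    and L A \<phi> k lower middle upper :: real
  assumes "n \<ge> 3" and "ngon n vs"
    and "a = side vs" and "L = (\<Sum>i<n. a i)" and "A = enclosed_area vs"
    and "\<phi> = A / pseudo_area n a"
    and "(1 < k \<and> k < 3/2 \<and> (\<forall>i<n. a i < k * L / real n)) \<or>
         (k = 1 \<and> (\<forall>i<n. a i = L / real n))"
    and "lower = 4 * A / (L\<^sup>2 * (1 - 2 / real n) powr (real n / 2))"
    and "middle = 4 * A / (L\<^sup>2 * (1 - 2 * k / real n) powr (real n / 2))"
    and "upper = 1 / (real n * tan (pi / real n) * (1 - 2 * k / real n) powr (real n / 2))"
  shows "(lower \<le> \<phi> \<and> \<phi> \<le> middle \<and> middle \<le> upper) \<and>
    (1 < k \<and> \<not> equilateral vs \<longrightarrow> lower < \<phi> \<and> \<phi> < middle \<and> middle < upper) \<and>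
    (lower = \<phi> \<longleftrightarrow> equilateral vs) \<and>
    (\<phi> = middle \<longleftrightarrow> k = 1) \<and>
    (middle = upper \<longleftrightarrow> regular vs) \<and>
    (lower = \<phi> \<and> \<phi> = middle \<and> middle = upper \<longleftrightarrow> regular vs \<and> k = 1)"
proof -
  have n: "n \<ge> 3" and ngon: "ngon n vs" using assms by auto
  have len: "length vs = n" using ngon by (simp add: ngon_def)
  have A: "A > 0" using polygon_isoperimetric(3)[OF n ngon] assms(5) by simp
  have tan: "tan (pi / n) > 0" using n by (intro tan_gt_zero) (auto simp: field_simps)
  have iso: "4 * real n * tan (pi / n) * A \<le> L\<^sup>2" "4 * real n * tan (pi / n) * A = L\<^sup>2 \<longleftrightarrow> regular vs"
    using polygon_isoperimetric[OF n ngon] unfolding assms(3-5) by auto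
  have "4 * real n * tan (pi / n) * A > 0" using A tan n by simp
  then have "L \<noteq> 0" using iso(1) by auto
  moreover have "L \<ge> 0" unfolding assms(3,4) by (intro sum_nonneg) (simp add: side_def)
  ultimately have L: "L > 0" by simp
  have k: "1 \<le> k" "k < 3 / 2" using assms(7) by auto
  have eqL: "equilateral vs \<longleftrightarrow> (\<forall>i<n. a i = L / n)"
  proof
    assume "equilateral vs"
    have eq: "a i = a 0" if "i < n" for i
    proof -
      have "i < length vs" "0 < length vs" using that len by auto
      with \<open>equilateral vs\<close> show ?thesis unfolding equilateral_def assms(3) by blast
    qed
    have "L = (\<Sum>i<n. a 0)" unfolding assms(4) by (intro sum.cong) (auto dest: eq)
    then have "a 0 = L / n" using n by simp
    then show "\<forall>i<n. a i = L / n" using eq by metis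
  next
    assume "\<forall>i<n. a i = L / n"
    then show "equilateral vs"
      unfolding equilateral_def len assms(3)[symmetric] by simp
  qed
  define u where "u = (\<lambda>i. 1 - 2 * a i / L)"
  define m where "m = 1 - 2 / real n"
  define q where "q = 1 - 2 * k / real n"
  have m: "m > 0" using n by (simp add: m_def)
  have "2 * k < 3" using k by simp
  also have "3 \<le> real n" using n by simp
  finally have q: "q > 0" using n by (simp add: q_def)
  have uq: "(1 < k \<and> (\<forall>i<n. u i > q)) \<or> (k = 1 \<and> (\<forall>i<n. u i = q))"
  proof -
    have "u i > q" if "a i < k * L / n" for i
    proof -
      have "2 * a i / L < 2 * (k * L / n) / L"
        using that L by (intro divide_strict_right_mono) auto
      then show ?thesis using L by (simp add: u_def q_def)
    qed
    moreover have "u i = q" if "a i = L / n" "k = 1" for i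
      using that L by (simp add: u_def q_def)
    ultimately show ?thesis using assms(7) by blast
  qed
  have upos: "u i > 0" if "i < n" for i
    using uq q that by fastforce
  have "(\<Sum>i<n. u i) = n - 2 * (\<Sum>i<n. a i) / L"
    by (simp add: u_def sum_subtractf flip: sum_divide_distrib sum_distrib_left)
  also have "\<dots> = n * m" using L n by (simp add: assms(4)[symmetric] m_def field_simps)
  finally have usum: "(\<Sum>i<n. u i) = n * m" .
  define Q where "Q = (\<Prod>i<n. u i)"
  have Pi: "Q > 0" unfolding Q_def using upos by (intro prod_pos) auto
  \<comment> \<open>All comparisons except the last one take place between values of this decreasing function.\<close>
  define G where "G = (\<lambda>x. 4 * A / (L\<^sup>2 * sqrt x))"
  have G_less: "G y < G x" if "0 < x" "x < y" for x y
    unfolding G_def using that A L by (intro divide_strict_left_mono mult_strict_left_mono mult_pos_pos) auto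
  have G_eq: "G x = G y \<longleftrightarrow> x = y" if "0 < x" "0 < y" for x y
    using G_less[of x y] G_less[of y x] that by (metis less_irrefl linorder_cases)
  have G_le: "G y \<le> G x" if "0 < x" "x \<le> y" for x y
    using G_less[of x y] that by fastforce
  have lower: "lower = G (m ^ n)"
    unfolding assms(8) G_def m_def[symmetric] using powr_half_nat[OF m] by simp
  have middle: "middle = G (q ^ n)"
    unfolding assms(9) G_def q_def[symmetric] using powr_half_nat[OF q] by simp
  have phi: "\<phi> = G Q"
    unfolding assms(6) pseudo_area_def Let_def assms(4)[symmetric] G_def Q_def u_def by simp
  have upper: "upper = 1 / (n * tan (pi / n) * sqrt (q ^ n))"
    unfolding assms(10) q_def[symmetric] using powr_half_nat[OF q] by simp
  have amgm: "Q \<le> m ^ n" "Q = m ^ n \<longleftrightarrow> (\<forall>i<n. u i = m)"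
    using prod_le_mean_power[OF upos m usum] unfolding Q_def by auto
  have "u i = m \<longleftrightarrow> a i = L / n" for i
    using L n by (auto simp: u_def m_def field_simps)
  with amgm eqL have amgm_eq: "Q = m ^ n \<longleftrightarrow> equilateral vs" by simp
  have low: "lower \<le> \<phi>" "lower = \<phi> \<longleftrightarrow> equilateral vs"
    using G_le[OF Pi amgm(1)] G_eq[of "m ^ n" Q] Pi m amgm_eq by (auto simp: lower phi)
  have qP: "q ^ n \<le> Q" "q ^ n = Q \<longleftrightarrow> k = 1"
  proof -
    have "q ^ n < Q" if "1 < k"
    proof -
      have "(\<Prod>i<n. q) < (\<Prod>i<n. u i)"
        using uq that q n by (intro prod_mono_strict[of 0]) (auto intro: less_imp_le)
      then show ?thesis by (simp add: Q_def)
    qed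
    moreover have "q ^ n = Q" if "k = 1"
      using uq that by (simp add: Q_def)
    ultimately show "q ^ n \<le> Q" "q ^ n = Q \<longleftrightarrow> k = 1"
      using k by fastforce+
  qed
  have mid: "\<phi> \<le> middle" "\<phi> = middle \<longleftrightarrow> k = 1"
    using G_le[OF _ qP(1)] G_eq[of Q "q ^ n"] Pi q qP(2) by (auto simp: middle phi)
  have sq: "sqrt (q ^ n) > 0" using q by simp
  have den: "L\<^sup>2 * (n * tan (pi / n) * sqrt (q ^ n)) > 0" using L tan sq n by simp
  \<comment> \<open>The sign of this difference is that of the isoperimetric deficit.\<close>
  have diff: "upper - middle = (L\<^sup>2 - 4 * real n * tan (pi / n) * A) / (L\<^sup>2 * (n * tan (pi / n) * sqrt (q ^ n)))"
  proof -
    have "1 / (c * s) - 4 * A / (l * s) = (l - 4 * c * A) / (l * (c * s))"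
      if "c \<noteq> 0" "s \<noteq> 0" "l \<noteq> 0" for c s l :: real
      using that by (simp add: diff_divide_distrib)
    from this[of "n * tan (pi / n)" "sqrt (q ^ n)" "L\<^sup>2"] show ?thesis
      using L tan q n by (simp add: upper middle G_def mult.assoc)
  qed
  have up: "middle \<le> upper" "middle = upper \<longleftrightarrow> regular vs"
  proof -
    have "upper - middle \<ge> 0" unfolding diff using iso(1) den by (intro divide_nonneg_pos) auto
    then show "middle \<le> upper" by simp
    have "upper - middle = 0 \<longleftrightarrow> regular vs" unfolding diff using iso(2) den q by auto
    then show "middle = upper \<longleftrightarrow> regular vs" by auto
  qed
  have "regular vs \<Longrightarrow> equilateral vs" by (simp add: regular_def)
  with low mid up show ?thesis by auto
qed

end
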